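(* Let $p,q$ be distinct primes and $G$ a finite abelian group of order $pq^2$. Then there exists no (nontrivial) $(pq^2,m,k,\lambda)$-SEDF in $G$ with $m>2$.
   Context: A $(v,m,k,\lambda)$-SEDF (strong external difference family) in a finite abelian group $G$ of order $v$ (written multiplicatively) is a collection $\{D_1,\dots,D_m\}$ of mutually disjoint $k$-subsets of $G$ such that for each $1\le j\le m$ and each non-identity $g\in G$, the number of pairs $(x,y)$ with $x\in D_j$, $y\in\bigcup_{i\ne j}D_i$, $xy^{-1}=g$ equals $\lambda$ (with $\lambda\ge1$). Nontrivial means $k>1$. *)

theory Defs
  imports "HOL-Library.Disjoint_Sets" "HOL-Algebra.Coset" "HOL-Computational_Algebra.Primes"
begin

text \<open>
  The blocks form a family \<open>D\<close> indexed by \<open>1, \<dots>, m\<close>; the values of \<open>D\<close> outside this range are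
  irrelevant. If \<open>k \<ge> 1\<close>, disjointness makes the blocks pairwise distinct, so that such a family
  is the same as a set of \<open>m\<close> blocks up to ordering. The trivial case \<open>k = 1\<close> is not excluded.
\<close>

definition sedf ::
  "('a, 'b) monoid_scheme \<Rightarrow> nat \<Rightarrow> nat \<Rightarrow> nat \<Rightarrow> nat \<Rightarrow> (nat \<Rightarrow> 'a set) \<Rightarrow> bool" where
  "sedf G v m k l D \<longleftrightarrow>
     comm_group G \<and> finite (carrier G) \<and> Coset.order G = v \<and> l \<ge> 1 \<and>
     (\<forall>j\<in>{1..m}. D j \<subseteq> carrier G \<and> card (D j) = k) \<and>
     disjoint_family_on D {1..m} \<and>
     (\<forall>j\<in>{1..m}. \<forall>g\<in>carrier G - {\<one>\<^bsub>G\<^esub>}.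
        card {(x, y). x \<in> D j \<and> y \<in> (\<Union>i\<in>{1..m} - {j}. D i) \<and> x \<otimes>\<^bsub>G\<^esub> inv\<^bsub>G\<^esub> y = g} = l)"

end

theory Submission
  imports Defs "HOL-Algebra.Sylow" "HOL-Algebra.Multiplicative_Group" "Jordan_Normal_Form.Char_Poly"
begin

text \<open>
  Write \<open>\<chi>(X)\<close> for the sum of a character \<open>\<chi>\<close> over \<open>X\<close>, let \<open>D\<close> be the union of the blocks, and
  let \<open>\<chi>\<close> be nontrivial. The group ring equation gives
  \<open>\<chi>(D\<^sub>j) cnj (\<chi>(D) - \<chi>(D\<^sub>j)) = -\<lambda>\<close>. If \<open>\<chi>(D) \<noteq> 0\<close>, the ratios \<open>\<chi>(D\<^sub>j) / \<chi>(D)\<close> are real roots of one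
  quadratic equation and sum to 1. Hence there are coprime \<open>0 < x < y\<close>, \<open>g > 0\<close> and an algebraic
  integer \<open>t\<close> with \<open>g (x + y) = m - 2\<close>, \<open>\<chi>(D\<^sub>j) = y t\<close> for \<open>g x + 1\<close> blocks, \<open>\<chi>(D\<^sub>j) = -x t\<close> for
  the other \<open>g y + 1\<close> blocks, and \<open>\<lambda> = n x y\<close> with \<open>n = |t|\<^sup>2\<close> an integer.

  If \<open>\<chi>\<close> takes only \<open>r\<close>-power roots of unity as values, \<open>r\<close> prime, then \<open>\<chi>(D\<^sub>j) \<equiv> k\<close> modulo every prime
  above \<open>r\<close>. So, if \<open>r\<close> does not divide \<open>k\<close>, either \<open>\<chi>(D) = 0\<close> and \<open>r\<close> divides \<open>m\<close>, or \<open>r\<close> divides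
  \<open>x + y\<close> and hence \<open>m - 2\<close>. Applying this to characters \<open>\<chi>\<close> of order \<open>p\<close> and \<open>\<psi>\<close> of \<open>q\<close>-power order
  and using \<open>k\<^sup>2 (m - 1) = \<lambda> (v - 1)\<close>, \<open>k m < v\<close> and \<open>\<lambda> < k\<close>, elementary arithmetic excludes all cases but
  one: \<open>p\<close> and \<open>q\<close> odd, \<open>\<chi>(D) = 0\<close>, \<open>p\<close> divides \<open>m\<close>, and \<open>q\<close> divides \<open>x + y\<close> for \<open>\<psi>\<close>. There the
  congruences \<open>\<chi>\<psi> \<equiv> \<chi>\<close> above \<open>q\<close> and \<open>\<chi>\<psi> \<equiv> \<psi>\<close> above \<open>p\<close> force \<open>(\<chi>\<psi>)(D) = 0\<close> and then that \<open>p\<close>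
  divides \<open>y - x\<close>, which is again arithmetically impossible.
\<close>

section \<open>Algebraic integers\<close>

text \<open>
  Multiplication by \<open>z\<close> preserves the integer span of the family \<open>v\<close>, so \<open>z\<close> is an eigenvalue of an
  integer matrix.
\<close>

definition int_stable :: "'i set \<Rightarrow> ('i \<Rightarrow> complex) \<Rightarrow> complex \<Rightarrow> bool" where
  "int_stable I v z \<longleftrightarrow> (\<exists>A. \<forall>i\<in>I. z * v i = (\<Sum>j\<in>I. of_int (A i j) * v j))"

lemma int_stable_add:
  assumes "int_stable I v z" "int_stable I v w"
  shows "int_stable I v (z + w)"
proof -
  obtain A where A: "\<forall>i\<in>I. z * v i = (\<Sum>j\<in>I. of_int (A i j) * v j)"
    using assms(1) unfolding int_stable_def by blast
  obtain B where B: "\<forall>i\<in>I. w * v i = (\<Sum>j\<in>I. of_int (B i j) * v j)"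
    using assms(2) unfolding int_stable_def by blast
  show ?thesis unfolding int_stable_def
    by (rule exI[of _ "\<lambda>i j. A i j + B i j"]) (simp add: A B ring_distribs sum.distrib)
qed

lemma int_stable_mult:
  assumes "finite I" "int_stable I v z" "int_stable I v w"
  shows "int_stable I v (z * w)"
proof -
  obtain A where A: "\<forall>i\<in>I. z * v i = (\<Sum>j\<in>I. of_int (A i j) * v j)"
    using assms(2) unfolding int_stable_def by blast
  obtain B where B: "\<forall>i\<in>I. w * v i = (\<Sum>j\<in>I. of_int (B i j) * v j)"
    using assms(3) unfolding int_stable_def by blast
  have "z * w * v i = (\<Sum>j\<in>I. of_int (\<Sum>k\<in>I. B i k * A k j) * v j)" if "i \<in> I" for i
  proof -
    have "z * w * v i = z * (\<Sum>k\<in>I. of_int (B i k) * v k)"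
      by (simp add: B that mult.assoc)
    also have "\<dots> = (\<Sum>k\<in>I. of_int (B i k) * (z * v k))"
      by (simp add: sum_distrib_left mult_ac)
    also have "\<dots> = (\<Sum>k\<in>I. \<Sum>j\<in>I. of_int (B i k * A k j) * v j)"
      by (intro sum.cong refl) (simp add: A sum_distrib_left mult_ac)
    also have "\<dots> = (\<Sum>j\<in>I. \<Sum>k\<in>I. of_int (B i k * A k j) * v j)"
      by (rule sum.swap)
    finally show ?thesis by (simp add: sum_distrib_right)
  qed
  then show ?thesis unfolding int_stable_def
    by (intro exI[of _ "\<lambda>i j. \<Sum>k\<in>I. B i k * A k j"] ballI)
qed

text \<open>Enumerating \<open>I\<close> makes \<open>v\<close> an eigenvector of an integer matrix,
  nonzero because of \<open>i0\<close>. So \<open>z\<close> is a root of the characteristic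
  polynomial, which is monic with integer coefficients.\<close>

lemma int_stable_imp_algebraic_int:
  fixes v :: "'i \<Rightarrow> complex"
  assumes fin: "finite I" and i0: "i0 \<in> I" "v i0 \<noteq> 0" and "int_stable I v z"
  shows "algebraic_int z"
proof -
  obtain A where A: "\<And>i. i \<in> I \<Longrightarrow> z * v i = (\<Sum>j\<in>I. of_int (A i j) * v j)"
    using assms(4) unfolding int_stable_def by blast
  define n where "n = card I"
  obtain f where f: "bij_betw f {0..<n} I"
    using fin n_def ex_bij_betw_nat_finite by blast
  have fI: "f i \<in> I" if "i < n" for i
    using f that by (auto simp: bij_betw_def)
  define M :: "int mat" where "M = mat n n (\<lambda>(i, j). A (f i) (f j))"
  define w where "w = vec n (\<lambda>i. v (f i))"
  let ?M = "map_mat of_int M :: complex mat"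
  have M: "M \<in> carrier_mat n n" and M': "?M \<in> carrier_mat n n" by (auto simp: M_def)
  have "?M *\<^sub>v w = z \<cdot>\<^sub>v w"
  proof (rule eq_vecI)
    fix i assume "i < dim_vec (z \<cdot>\<^sub>v w)"
    then have i: "i < n" by (simp add: w_def)
    have "(?M *\<^sub>v w) $ i = (\<Sum>j = 0..<n. of_int (A (f i) (f j)) * v (f j))"
      using i by (simp add: M_def w_def scalar_prod_def)
    also have "\<dots> = (\<Sum>j\<in>I. of_int (A (f i) j) * v j)"
      by (rule sum.reindex_bij_betw[OF f])
    also have "\<dots> = z * v (f i)" using A fI i by simp
    finally show "(?M *\<^sub>v w) $ i = (z \<cdot>\<^sub>v w) $ i" using i by (simp add: w_def)
  qed (simp add: M_def w_def)
  moreover have "w \<noteq> 0\<^sub>v n"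
  proof
    assume w0: "w = 0\<^sub>v n"
    obtain i where i: "i < n" "f i = i0" using f i0(1) by (auto simp: bij_betw_def)
    from i w0 have "v i0 = 0" by (metis index_vec index_zero_vec(1) w_def)
    with i0 show False by simp
  qed
  moreover have "w \<in> carrier_vec n" by (simp add: w_def)
  ultimately have "eigenvalue ?M z"
    using M' unfolding eigenvalue_def eigenvector_def by auto
  then have "poly (char_poly ?M) z = 0" using eigenvalue_root_char_poly[OF M'] by simp
  then have "poly (map_poly of_int (char_poly M)) z = 0"
    by (simp add: of_int_hom.char_poly_hom[OF M])
  moreover have "lead_coeff (char_poly M) = 1"
    using degree_monic_char_poly[OF M] by (simp)
  ultimately show ?thesis by (auto simp: algebraic_int_altdef_ipoly)
qed

lemma algebraic_int_power_reduction:
  assumes "algebraic_int (a :: complex)"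
  obtains n c where "n > 0" "a ^ n = (\<Sum>i<n. of_int (c i) * a ^ i)"
proof -
  obtain f where f: "poly (map_poly of_int f) a = 0" "lead_coeff f = 1"
    using assms by (auto simp: algebraic_int_altdef_ipoly)
  let ?n = "degree f"
  have n: "?n > 0"
  proof (rule ccontr)
    assume "\<not> ?n > 0"
    then obtain c where "f = [:c:]" by (auto elim: degree_eq_zeroE)
    with f show False by simp
  qed
  have "0 = (\<Sum>i\<le>?n. of_int (Polynomial.coeff f i) * a ^ i)"
    using f(1) by (simp add: poly_altdef)
  also have "{..?n} = insert ?n {..<?n}" by auto
  finally have "a ^ ?n = (\<Sum>i<?n. of_int (- Polynomial.coeff f i) * a ^ i)"
    using f(2) by (simp add: sum_negf eq_neg_iff_add_eq_0)
  with n show ?thesis by (rule that)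
qed

text \<open>The second version, with the factors exchanged, is the one to instantiate for the other
  generator, so that both generators act on the same family.\<close>

lemma int_stable_power_product:
  assumes n: "n > 0" "(a :: complex) ^ n = (\<Sum>i<n. of_int (c i) * a ^ i)"
  shows "int_stable ({..<n} \<times> {..<m}) (\<lambda>(i, j). a ^ i * b ^ j) a"
    and "int_stable ({..<m} \<times> {..<n}) (\<lambda>(j, i). b ^ j * a ^ i) a"
proof -
  \<comment> \<open>The companion matrix of the relation for \<open>a ^ n\<close>: a shift in all
    rows but the last, which holds the coefficients \<open>c\<close>.\<close>
  define A where "A i i' = (if i < n - 1 then of_bool (i' = i + 1) else c i')" for i i'
  have A: "a * a ^ i = (\<Sum>i'<n. of_int (A i i') * a ^ i')" if "i < n" for i
  proof (cases "i < n - 1")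
    case True
    then have "(\<Sum>i'<n. of_int (A i i') * a ^ i') = (\<Sum>i'<n. if i' = i + 1 then a ^ i' else 0)"
      by (intro sum.cong) (auto simp: A_def)
    also have "\<dots> = a ^ (i + 1)" using True by (subst sum.delta) auto
    finally show ?thesis by simp
  next
    case False
    with that have "Suc i = n" by simp
    with False show ?thesis using n(2) by (simp add: A_def flip: power_Suc)
  qed
  have eq: "a * (a ^ i * b ^ j) =
      (\<Sum>i'<n. \<Sum>j'<m. of_int (A i i' * of_bool (j' = j)) * (a ^ i' * b ^ j'))"
    if "i < n" "j < m" for i j
  proof -
    have "(\<Sum>j'<m. of_int (A i i' * of_bool (j' = j)) * (a ^ i' * b ^ j')) =
        of_int (A i i') * a ^ i' * b ^ j" for i'
    proof -
      have "(\<Sum>j'<m. of_int (A i i' * of_bool (j' = j)) * (a ^ i' * b ^ j')) =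
          (\<Sum>j'<m. if j' = j then of_int (A i i') * a ^ i' * b ^ j' else 0)"
        by (intro sum.cong) auto
      then show ?thesis using that by simp
    qed
    then have "(\<Sum>i'<n. \<Sum>j'<m. of_int (A i i' * of_bool (j' = j)) * (a ^ i' * b ^ j')) =
        (\<Sum>i'<n. of_int (A i i') * a ^ i') * b ^ j"
      by (simp add: sum_distrib_right)
    with A[OF that(1)] show ?thesis by (simp add: mult_ac)
  qed
  show "int_stable ({..<n} \<times> {..<m}) (\<lambda>(i, j). a ^ i * b ^ j) a"
    unfolding int_stable_def
    by (rule exI[of _ "\<lambda>(i, j) (i', j'). A i i' * of_bool (j' = j)"])
       (auto simp: eq sum.cartesian_product split_def)
  have "a * (b ^ j * a ^ i) =
      (\<Sum>j'<m. \<Sum>i'<n. of_int (A i i' * of_bool (j' = j)) * (b ^ j' * a ^ i'))"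
    if "i < n" "j < m" for i j
    using eq[OF that] by (subst sum.swap) (simp add: mult_ac)
  then show "int_stable ({..<m} \<times> {..<n}) (\<lambda>(j, i). b ^ j * a ^ i) a"
    unfolding int_stable_def
    by (intro exI[of _ "\<lambda>(j, i) (j', i'). A i i' * of_bool (j' = j)"])
       (auto simp: sum.cartesian_product split_def)
qed

text \<open>The finitely many products \<open>a ^ i * b ^ j\<close> with \<open>i < n\<close>,
  \<open>j < m\<close> span a module preserved by both \<open>a\<close> and \<open>b\<close>, hence
  by their sum and product.\<close>

lemma
  assumes "algebraic_int (a :: complex)" "algebraic_int b"
  shows algebraic_int_add: "algebraic_int (a + b)"
    and algebraic_int_mult: "algebraic_int (a * b)"
proof -
  obtain n c where n: "n > 0" "a ^ n = (\<Sum>i<n. of_int (c i) * a ^ i)"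
    using algebraic_int_power_reduction assms(1) by blast
  obtain m d where m: "m > 0" "b ^ m = (\<Sum>i<m. of_int (d i) * b ^ i)"
    using algebraic_int_power_reduction assms(2) by blast
  define I where "I = {..<n} \<times> {..<m}"
  define v where "v = (\<lambda>(i, j). a ^ i * b ^ j)"
  have I: "finite I" "(0, 0) \<in> I" "v (0, 0) \<noteq> 0" using n m by (auto simp: I_def v_def)
  have a: "int_stable I v a" unfolding I_def v_def by (rule int_stable_power_product(1)[OF n])
  have b: "int_stable I v b" unfolding I_def v_def by (rule int_stable_power_product(2)[OF m])
  show "algebraic_int (a + b)"
    by (rule int_stable_imp_algebraic_int[OF I int_stable_add[OF a b]])
  show "algebraic_int (a * b)"
    by (rule int_stable_imp_algebraic_int[OF I int_stable_mult[OF I(1) a b]])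
qed

lemma algebraic_int_diff: "algebraic_int (a :: complex) \<Longrightarrow> algebraic_int b \<Longrightarrow> algebraic_int (a - b)"
  using algebraic_int_add[of a "- b"] by simp

lemma algebraic_int_power: "algebraic_int (a :: complex) \<Longrightarrow> algebraic_int (a ^ n)"
  by (induction n) (auto intro: algebraic_int_mult int_imp_algebraic_int)

lemma algebraic_int_sum:
  "(\<And>x. x \<in> A \<Longrightarrow> algebraic_int (f x :: complex)) \<Longrightarrow> algebraic_int (sum f A)"
  by (induction A rule: infinite_finite_induct) (auto intro: algebraic_int_add)

lemma algebraic_int_of_nat [simp]: "algebraic_int (of_nat n :: complex)"
  by (intro int_imp_algebraic_int) auto

lemma algebraic_int_of_int [simp]: "algebraic_int (of_int n :: complex)"
  by (intro int_imp_algebraic_int) auto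

lemma algebraic_int_root_of_unity: "z ^ n = 1 \<Longrightarrow> n > 0 \<Longrightarrow> algebraic_int (z :: complex)"
  by (rule algebraic_int_root[of 1 "Polynomial.monom 1 n"])
     (auto simp: poly_monom degree_monom_eq intro: int_imp_algebraic_int)

text \<open>
  The radical of the ideal generated by \<open>r\<close> in the ring of algebraic integers, that is, the
  intersection of the primes above \<open>r\<close>.
\<close>

definition prime_rad :: "nat \<Rightarrow> complex set" where
  "prime_rad r = {z. algebraic_int z \<and> (\<exists>n. algebraic_int (z ^ n / of_nat r))}"

text \<open>In the binomial expansion of \<open>(z + w) ^ (n + m)\<close> every term contains
  \<open>z ^ n\<close> or \<open>w ^ m\<close>, hence is divisible by \<open>r\<close>.\<close>

lemma prime_rad_add:
  assumes "z \<in> prime_rad r" "w \<in> prime_rad r"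
  shows "z + w \<in> prime_rad r"
proof -
  obtain n m where n: "algebraic_int (z ^ n / of_nat r)" and m: "algebraic_int (w ^ m / of_nat r)"
    and z: "algebraic_int z" and w: "algebraic_int w"
    using assms by (auto simp: prime_rad_def)
  have "algebraic_int (of_nat ((n + m) choose i) * z ^ i * w ^ (n + m - i) / of_nat r)"
    if "i \<le> n + m" for i
  proof (cases "i \<ge> n")
    case True
    then have "z ^ i = z ^ n * z ^ (i - n)" by (simp flip: power_add)
    then have "of_nat ((n + m) choose i) * z ^ i * w ^ (n + m - i) / of_nat r =
        of_nat ((n + m) choose i) * (z ^ n / of_nat r) * z ^ (i - n) * w ^ (n + m - i)" by simp
    then show ?thesis using n z w by (simp only:) (intro algebraic_int_mult algebraic_int_power; simp)
  next
    case False
    then have "w ^ (n + m - i) = w ^ m * w ^ (n - i)"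
      by (simp add: add.commute flip: power_add)
    then have "of_nat ((n + m) choose i) * z ^ i * w ^ (n + m - i) / of_nat r =
        of_nat ((n + m) choose i) * z ^ i * (w ^ m / of_nat r) * w ^ (n - i)" by simp
    then show ?thesis using m z w by (simp only:) (intro algebraic_int_mult algebraic_int_power; simp)
  qed
  then have "algebraic_int ((z + w) ^ (n + m) / of_nat r)"
    unfolding binomial_ring sum_divide_distrib by (intro algebraic_int_sum) auto
  with z w show ?thesis by (auto simp: prime_rad_def intro: algebraic_int_add)
qed

lemma prime_rad_mult:
  assumes "z \<in> prime_rad r" "algebraic_int w"
  shows "w * z \<in> prime_rad r"
proof -
  obtain n where n: "algebraic_int (z ^ n / of_nat r)" and z: "algebraic_int z"
    using assms by (auto simp: prime_rad_def)
  have "(w * z) ^ n / of_nat r = w ^ n * (z ^ n / of_nat r)" by (simp add: power_mult_distrib)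
  then have "algebraic_int ((w * z) ^ n / of_nat r)"
    using n assms(2) by (simp only:) (intro algebraic_int_mult algebraic_int_power)
  then show ?thesis using z assms(2) by (auto simp: prime_rad_def intro: algebraic_int_mult)
qed

lemma prime_rad_uminus: "z \<in> prime_rad r \<Longrightarrow> - z \<in> prime_rad r"
  using prime_rad_mult[of z r "- 1"] by simp

lemma prime_rad_minus_commute: "z - w \<in> prime_rad r \<longleftrightarrow> w - z \<in> prime_rad r"
  using prime_rad_uminus[of "z - w" r] prime_rad_uminus[of "w - z" r] by auto

lemma prime_rad_diff: "z \<in> prime_rad r \<Longrightarrow> w \<in> prime_rad r \<Longrightarrow> z - w \<in> prime_rad r"
  using prime_rad_add[of z r "- w"] prime_rad_mult[of w r "- 1"] by simp

lemma prime_rad_0 [simp]: "0 \<in> prime_rad r"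
  by (auto simp: prime_rad_def intro!: exI[of _ 1])

lemma prime_rad_sum: "(\<And>x. x \<in> A \<Longrightarrow> f x \<in> prime_rad r) \<Longrightarrow> sum f A \<in> prime_rad r"
  by (induction A rule: infinite_finite_induct) (auto intro: prime_rad_add)

lemma prime_rad_power: "z ^ n \<in> prime_rad r \<Longrightarrow> algebraic_int z \<Longrightarrow> z \<in> prime_rad r"
  by (auto simp: prime_rad_def simp flip: power_mult)

lemma prime_rad_of_nat_mult: "algebraic_int w \<Longrightarrow> r > 0 \<Longrightarrow> of_nat r * w \<in> prime_rad r"
  by (auto simp: prime_rad_def intro!: exI[of _ 1] algebraic_int_mult)

text \<open>The passage from congruences back to integers: \<open>a ^ n / r\<close> is a rational
  algebraic integer and therefore an integer.\<close>

lemma of_int_in_prime_rad_imp_dvd: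
  assumes r: "Factorial_Ring.prime r" and "of_int a \<in> prime_rad r"
  shows "int r dvd a"
proof -
  obtain n where n: "algebraic_int ((of_int a :: complex) ^ n / of_nat r)"
    using assms by (auto simp: prime_rad_def)
  have "(of_int a :: complex) ^ n / of_nat r \<in> \<rat>" by (intro Rats_divide Rats_power) auto
  with n have "(of_int a :: complex) ^ n / of_nat r \<in> \<int>" by (rule rational_algebraic_int_is_int)
  then obtain b where "(of_int a :: complex) ^ n / of_nat r = of_int b" by (auto elim: Ints_cases)
  then have "(of_int (a ^ n) :: complex) = of_int (int r * b)"
    using prime_gt_0_nat[OF r] by (simp add: field_simps)
  then have "a ^ n = int r * b" by (simp only: of_int_eq_iff)
  then have "int r dvd a ^ n" by simp
  then show ?thesis using r prime_dvd_power[of "int r" a n] by simp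
qed

lemma of_nat_in_prime_rad_imp_dvd:
  assumes "Factorial_Ring.prime r" "of_nat a \<in> prime_rad r"
  shows "r dvd a"
  using of_int_in_prime_rad_imp_dvd[OF assms(1), of "int a"] assms(2) by simp

text \<open>Induction through \<open>z ^ r\<close>: the inner binomial coefficients are divisible by
  \<open>r\<close>, so \<open>(1 - z) ^ r\<close> is congruent to \<open>1 - z ^ r\<close>, and a
  radical is closed under taking roots.\<close>

lemma one_minus_prime_power_root_in_prime_rad:
  assumes r: "Factorial_Ring.prime r"
  shows "z ^ (r ^ n) = 1 \<Longrightarrow> 1 - z \<in> prime_rad r"
proof (induction n arbitrary: z)
  case 0
  then show ?case by simp
next
  case (Suc n)
  have r0: "r > 0" using r prime_gt_0_nat by blast
  have z: "algebraic_int z" using algebraic_int_root_of_unity[OF Suc.prems] r0 by simp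
  have "(z ^ r) ^ r ^ n = 1" using Suc.prems by (simp flip: power_mult)
  then have *: "1 - z ^ r \<in> prime_rad r" by (rule Suc.IH)
  have "(1 - z) ^ r = (- z + 1) ^ r" by simp
  also have "\<dots> = (\<Sum>i\<le>r. of_nat (r choose i) * (- z) ^ i)"
    by (subst binomial_ring) (simp add: mult_ac)
  also have "{..r} = insert 0 (insert r {1..<r})" using r0 by auto
  finally have eq: "(1 - z) ^ r = (1 + (- z) ^ r) + (\<Sum>i\<in>{1..<r}. of_nat (r choose i) * (- z) ^ i)"
    using r0 by simp
  have "of_nat (r choose i) * (- z) ^ i \<in> prime_rad r" if "i \<in> {1..<r}" for i
  proof -
    have "r dvd (r choose i)" using that r by (intro dvd_choose_prime) auto
    then obtain c where "r choose i = r * c" by blast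
    then have "of_nat (r choose i) * (- z) ^ i = of_nat r * (of_nat c * (- z) ^ i)" by simp
    also have "\<dots> \<in> prime_rad r"
      using z r0 by (intro prime_rad_of_nat_mult algebraic_int_mult algebraic_int_power) auto
    finally show ?thesis .
  qed
  then have s: "(\<Sum>i\<in>{1..<r}. of_nat (r choose i) * (- z) ^ i) \<in> prime_rad r"
    by (rule prime_rad_sum)
  have "1 + (- z) ^ r \<in> prime_rad r"
  \<comment> \<open>Only the sign depends on parity: for odd \<open>r\<close> this is
    \<open>1 - z ^ r\<close>, for \<open>r = 2\<close> it differs from that by
    \<open>2 * z ^ 2\<close>.\<close>
  proof (cases "r = 2")
    case True
    have "1 + (- z) ^ r = (1 - z ^ r) + of_nat r * z ^ r" by (simp add: True)
    with * z r0 show ?thesis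
      by (simp only:) (intro prime_rad_add prime_rad_of_nat_mult algebraic_int_power; simp)
  next
    case False
    then have "odd r" using r prime_odd_nat prime_ge_2_nat[OF r] by force
    with * show ?thesis by simp
  qed
  with eq s have "(1 - z) ^ r \<in> prime_rad r" by (simp add: prime_rad_add)
  then show ?case by (rule prime_rad_power) (intro algebraic_int_diff z; simp)
qed

section \<open>Characters of finite abelian groups\<close>

text \<open>Values off the carrier are left free, so that pointwise products and powers of
  characters are again characters without any restriction of the functions.\<close>

definition character :: "('a, 'b) monoid_scheme \<Rightarrow> ('a \<Rightarrow> complex) \<Rightarrow> bool" where
  "character G \<chi> \<longleftrightarrow> \<chi> \<one>\<^bsub>G\<^esub> = 1 \<and>
     (\<forall>x\<in>carrier G. \<forall>y\<in>carrier G. \<chi> (x \<otimes>\<^bsub>G\<^esub> y) = \<chi> x * \<chi> y)"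

lemma character_one: "character G \<chi> \<Longrightarrow> \<chi> \<one>\<^bsub>G\<^esub> = 1"
  by (simp add: character_def)

lemma character_mult:
  "character G \<chi> \<Longrightarrow> x \<in> carrier G \<Longrightarrow> y \<in> carrier G \<Longrightarrow> \<chi> (x \<otimes>\<^bsub>G\<^esub> y) = \<chi> x * \<chi> y"
  by (simp add: character_def)

lemma character_pow:
  assumes "monoid G" "character G \<chi>" "x \<in> carrier G"
  shows "\<chi> (x [^]\<^bsub>G\<^esub> (n :: nat)) = \<chi> x ^ n"
proof -
  interpret monoid G by fact
  show ?thesis
    using assms(2,3) by (induction n) (simp_all add: character_one character_mult)
qed

lemma character_times: "character G \<chi> \<Longrightarrow> character G \<psi> \<Longrightarrow> character G (\<lambda>x. \<chi> x * \<psi> x)"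
  by (simp add: character_def)

lemma character_power: "character G \<chi> \<Longrightarrow> character G (\<lambda>x. \<chi> x ^ n)"
  by (simp add: character_def power_mult_distrib)

lemma (in group) subgroup_pow_closed:
  assumes "subgroup H G" "x \<in> H"
  shows "x [^] (n :: nat) \<in> H"
  using assms by (induction n) (auto intro: subgroup.one_closed subgroup.m_closed)

text \<open>Here \<open>d\<close> is the order of the coset of \<open>a\<close> modulo
  \<open>H\<close>, obtained as the least positive exponent; division with remainder does the
  rest.\<close>

lemma (in group) exponent_modulo_subgroup:
  assumes fin: "finite (carrier G)" and H: "subgroup H G" and a: "a \<in> carrier G"
  obtains d :: nat where "d > 0" "\<And>n :: nat. a [^] n \<in> H \<longleftrightarrow> d dvd n"
proof -
  define d where "d = (LEAST n :: nat. n > 0 \<and> a [^] n \<in> H)"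
  have "Coset.order G > 0" using fin order_gt_0_iff_finite by blast
  moreover have "a [^] Coset.order G \<in> H"
    using a pow_order_eq_1 H by (simp add: subgroup.one_closed)
  ultimately have ex: "\<exists>n :: nat. n > 0 \<and> a [^] n \<in> H" by blast
  have d: "d > 0" "a [^] d \<in> H" using LeastI_ex[OF ex] unfolding d_def by auto
  have least: "d \<le> n" if "n > 0" "a [^] n \<in> H" for n
    unfolding d_def using that by (intro Least_le) auto
  have dvd: "d dvd n" if n: "a [^] n \<in> H" for n
  proof -
    have q: "a [^] (d * (n div d)) \<in> H"
      using subgroup_pow_closed[OF H d(2), of "n div d"] a by (simp add: nat_pow_pow)
    have "a [^] n = a [^] (d * (n div d)) \<otimes> a [^] (n mod d)"
      using a by (simp add: nat_pow_mult)
    then have "a [^] (n mod d) = inv (a [^] (d * (n div d))) \<otimes> a [^] n"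
      using a by (simp add: inv_solve_left)
    then have "a [^] (n mod d) \<in> H"
      using q n H by (simp add: subgroup.m_closed subgroup.m_inv_closed)
    with least[of "n mod d"] d(1) show ?thesis
      by (meson dvd_eq_mod_eq_0 leD mod_less_divisor neq0_conv)
  qed
  have "a [^] n \<in> H" if "d dvd n" for n
  proof -
    from that obtain e where "n = d * e" by blast
    then show ?thesis using subgroup_pow_closed[OF H d(2), of e] a by (simp add: nat_pow_pow)
  qed
  with dvd d(1) show ?thesis by (intro that[of d]) blast+
qed

text \<open>The new character sends \<open>h \<otimes> a [^] i\<close> to
  \<open>\<chi> h * w ^ i\<close>. The condition \<open>w ^ d = \<chi> (a [^] d)\<close> makes this
  independent of the chosen representation.\<close>

lemma (in comm_group) extend_character_by_element:
  assumes fin: "finite (carrier G)" and H: "subgroup H G"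
    and \<chi>: "character (G\<lparr>carrier := H\<rparr>) \<chi>" and a: "a \<in> carrier G"
    and d: "\<And>n :: nat. a [^] n \<in> H \<longleftrightarrow> d dvd n" and w: "w ^ d = \<chi> (a [^] d)" "w \<noteq> 0"
  obtains H' \<chi>' where "subgroup H' G" "character (G\<lparr>carrier := H'\<rparr>) \<chi>'" "H \<subseteq> H'" "a \<in> H'"
    "\<And>x. x \<in> H \<Longrightarrow> \<chi>' x = \<chi> x" "\<chi>' a = w"
proof -
  have HG: "H \<subseteq> carrier G" using H subgroup.subset by blast
  have \<chi>1: "\<chi> \<one> = 1" using character_one[OF \<chi>] by simp
  have \<chi>m: "\<chi> (x \<otimes> y) = \<chi> x * \<chi> y" if "x \<in> H" "y \<in> H" for x y
    using character_mult[OF \<chi>, of x y] that by simp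
  have \<chi>p: "\<chi> (a [^] n) = w ^ n" if "d dvd n" for n
  proof -
    from that obtain e where e: "n = d * e" by blast
    have ad: "a [^] d \<in> H" using d by simp
    have "\<chi> ((a [^] d) [^] e) = \<chi> (a [^] d) ^ e"
    proof (induction e)
      case (Suc e)
      then show ?case
        using \<chi>m[OF subgroup_pow_closed[OF H ad, of e] ad] by (simp add: mult.commute)
    qed (simp add: \<chi>1)
    then show ?thesis using a w by (simp add: e nat_pow_pow power_mult)
  qed
  \<comment> \<open>Natural exponents suffice: in a finite group the inverse of a power of
    \<open>a\<close> is again such a power.\<close>
  define H' where "H' = {h \<otimes> a [^] i | h i. h \<in> H \<and> i \<in> (UNIV :: nat set)}"
  have le: "\<chi> h * w ^ i = \<chi> h' * w ^ j"
    if "h \<in> H" "h' \<in> H" "h \<otimes> a [^] i = h' \<otimes> a [^] j" "i \<le> j" for h h' and i j :: nat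
  proof -
    have "h' \<otimes> a [^] j = (h' \<otimes> a [^] (j - i)) \<otimes> a [^] i"
      using that HG a by (simp add: m_assoc nat_pow_mult subset_iff)
    then have h: "h = h' \<otimes> a [^] (j - i)"
      using that HG a by (metis (no_types, lifting) m_closed nat_pow_closed right_cancel subsetD)
    then have "a [^] (j - i) = inv h' \<otimes> h"
      using that HG a by (simp add: inv_solve_left subset_iff)
    then have mem: "a [^] (j - i) \<in> H"
      using that H by (simp add: subgroup.m_closed subgroup.m_inv_closed)
    then have "\<chi> h = \<chi> h' * w ^ (j - i)"
      using h \<chi>m[OF that(2) mem] \<chi>p d by simp
    then show ?thesis using that(4) by (simp flip: power_add)
  qed
  have wd: "\<chi> h * w ^ i = \<chi> h' * w ^ j"
    if "h \<in> H" "h' \<in> H" "h \<otimes> a [^] i = h' \<otimes> a [^] j" for h h' and i j :: nat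
    using le[OF that] le[OF that(2,1) that(3)[symmetric]] by (metis nat_le_linear)
  define \<chi>' where "\<chi>' x = (SOME c. \<exists>h\<in>H. \<exists>i :: nat. x = h \<otimes> a [^] i \<and> c = \<chi> h * w ^ i)" for x
  have eval: "\<chi>' (h \<otimes> a [^] i) = \<chi> h * w ^ i" if "h \<in> H" for h and i :: nat
    unfolding \<chi>'_def
  proof (rule some_equality)
    fix c assume "\<exists>h'\<in>H. \<exists>j :: nat. h \<otimes> a [^] i = h' \<otimes> a [^] j \<and> c = \<chi> h' * w ^ j"
    then show "c = \<chi> h * w ^ i" using wd that by metis
  qed (use that in blast)
  have mult: "(h \<otimes> a [^] i) \<otimes> (h' \<otimes> a [^] j) = (h \<otimes> h') \<otimes> a [^] (i + j)"
    if "h \<in> H" "h' \<in> H" for h h' and i j :: nat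
    using that HG a by (simp add: m_ac nat_pow_mult[symmetric] subset_iff)
  have "subgroup H' G"
  proof (rule subgroupI)
    show "H' \<subseteq> carrier G" using HG a by (auto simp: H'_def)
    show "H' \<noteq> {}" using H subgroup.one_closed by (fastforce simp: H'_def)
    fix x assume "x \<in> H'"
    then obtain h and i :: nat where x: "x = h \<otimes> a [^] i" "h \<in> H" by (auto simp: H'_def)
    have hG: "h \<in> carrier G" using x HG by blast
    have o: "Coset.order G > 0" using fin order_gt_0_iff_finite by blast
    have "(a [^] i) \<otimes> (a [^] i) [^] (Coset.order G - 1) = (a [^] i) [^] (Coset.order G)"
      using a o by (metis Suc_diff_1 nat_pow_Suc2 nat_pow_closed)
    then have "inv (a [^] i) = (a [^] i) [^] (Coset.order G - 1)"
      using a pow_order_eq_1 by (intro inv_unique'[symmetric]) (auto simp: m_comm)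
    then have "inv x = inv h \<otimes> a [^] (i * (Coset.order G - 1))"
      using x hG a by (simp add: inv_mult nat_pow_pow)
    then show "inv x \<in> H'" using x H by (auto simp: H'_def subgroup.m_inv_closed)
    fix y assume "y \<in> H'"
    then obtain h' and j :: nat where y: "y = h' \<otimes> a [^] j" "h' \<in> H" by (auto simp: H'_def)
    show "x \<otimes> y \<in> H'"
      using mult[OF x(2) y(2)] x y subgroup.m_closed[OF H x(2) y(2)] by (auto simp: H'_def)
  qed
  moreover have "H \<subseteq> H'"
  proof
    fix h assume "h \<in> H"
    then have "h = h \<otimes> a [^] (0 :: nat)" using HG by auto
    with \<open>h \<in> H\<close> show "h \<in> H'" unfolding H'_def by blast
  qed
  moreover have ext: "\<chi>' x = \<chi> x" if "x \<in> H" for x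
    using eval[OF that, of 0] that HG by (simp add: subset_iff)
  moreover have "character (G\<lparr>carrier := H'\<rparr>) \<chi>'"
    unfolding character_def
  proof (intro conjI ballI)
    show "\<chi>' \<one>\<^bsub>G\<lparr>carrier := H'\<rparr>\<^esub> = 1" using ext \<chi>1 H by (simp add: subgroup.one_closed)
    fix x y assume "x \<in> carrier (G\<lparr>carrier := H'\<rparr>)" "y \<in> carrier (G\<lparr>carrier := H'\<rparr>)"
    then obtain h h' and i j :: nat
      where x: "x = h \<otimes> a [^] i" "h \<in> H" and y: "y = h' \<otimes> a [^] j" "h' \<in> H"
      by (auto simp: H'_def)
    show "\<chi>' (x \<otimes>\<^bsub>G\<lparr>carrier := H'\<rparr>\<^esub> y) = \<chi>' x * \<chi>' y"
      using x y H by (simp add: mult eval subgroup.m_closed \<chi>m power_add)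
  qed
  moreover have "a = \<one> \<otimes> a [^] (1 :: nat)" using a by simp
  then have "a \<in> H'" "\<chi>' a = w"
    using eval[of \<one> 1] H subgroup.one_closed[OF H] \<chi>1 unfolding H'_def by (blast, simp add: a)
  ultimately show ?thesis by (intro that[of H' \<chi>'])
qed

lemma complex_root_exists:
  assumes "d > 0" "c \<noteq> 0"
  obtains w :: complex where "w ^ d = c" "w \<noteq> 0"
proof
  let ?w = "complex_of_real (root d (cmod c)) * cis (Arg c / real d)"
  have "?w ^ d = complex_of_real (root d (cmod c) ^ d) * cis (Arg c)"
    using assms(1) by (simp add: power_mult_distrib DeMoivre of_real_power del: real_root_pow_pos2)
  also have "\<dots> = c"
    using assms by (simp add: cis_Arg sgn_eq)
  finally show "?w ^ d = c" .
  with assms show "?w \<noteq> 0" by (metis power_0_left not_gr_zero)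
qed

text \<open>Nonzero complex numbers have roots of every order, so a character extends to a subgroup
  containing one more element; induction on the number of missing elements reaches the whole
  group.\<close>

lemma (in comm_group) extend_character:
  assumes fin: "finite (carrier G)"
  shows "subgroup H G \<Longrightarrow> character (G\<lparr>carrier := H\<rparr>) \<chi> \<Longrightarrow>
    \<exists>\<chi>'. character G \<chi>' \<and> (\<forall>x\<in>H. \<chi>' x = \<chi> x)"
proof (induction "card (carrier G) - card H" arbitrary: H \<chi> rule: less_induct)
  case less
  note H = less.prems(1) and \<chi> = less.prems(2)
  have HG: "H \<subseteq> carrier G" using H subgroup.subset by blast
  show ?case
  proof (cases "H = carrier G")
    case True
    then show ?thesis using \<chi> by auto
  next
    case False
    then obtain a where a: "a \<in> carrier G" "a \<notin> H" using HG by blast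
    obtain d where d: "d > 0" "\<And>n :: nat. a [^] n \<in> H \<longleftrightarrow> d dvd n"
      using exponent_modulo_subgroup[OF fin H a(1)] by blast
    have ad: "a [^] d \<in> H" "inv (a [^] d) \<in> H" using d H by (auto simp: subgroup.m_inv_closed)
    have "\<chi> (a [^] d) * \<chi> (inv (a [^] d)) = 1"
      using character_mult[OF \<chi>, of "a [^] d" "inv (a [^] d)"] character_one[OF \<chi>] ad a by simp
    then have "\<chi> (a [^] d) \<noteq> 0" by auto
    then obtain w where w: "w ^ d = \<chi> (a [^] d)" "w \<noteq> 0"
      using complex_root_exists d(1) by blast
    obtain H' \<chi>' where H': "subgroup H' G" "character (G\<lparr>carrier := H'\<rparr>) \<chi>'" "H \<subseteq> H'" "a \<in> H'"
      "\<And>x. x \<in> H \<Longrightarrow> \<chi>' x = \<chi> x"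
      using extend_character_by_element[OF fin H \<chi> a(1) d(2) w] by metis
    have H'G: "H' \<subseteq> carrier G" using H' subgroup.subset by blast
    have "card H < card H'"
      using H' a H'G fin by (intro psubset_card_mono) (auto intro: finite_subset)
    moreover have "card H' \<le> card (carrier G)" using H'G fin by (simp add: card_mono)
    ultimately have "card (carrier G) - card H' < card (carrier G) - card H" by linarith
    from less.hyps[OF this H'(1,2)] H'(3,5) show ?thesis by (metis subsetD)
  qed
qed

text \<open>The trivial character of the trivial subgroup is extended with a prescribed value at
  \<open>a\<close>: a \<open>d\<close>-th root of unity other than 1, where \<open>d\<close> is the
  order of \<open>a\<close>.\<close>

lemma (in comm_group) characters_separate_points:
  assumes fin: "finite (carrier G)" and a: "a \<in> carrier G" "a \<noteq> \<one>"
  obtains \<chi> where "character G \<chi>" "\<chi> a \<noteq> 1"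
proof -
  have triv: "subgroup {\<one>} G" by (rule triv_subgroup)
  obtain d where d: "d > 0" "\<And>n :: nat. a [^] n \<in> {\<one>} \<longleftrightarrow> d dvd n"
    using exponent_modulo_subgroup[OF fin triv a(1)] by blast
  have "d \<noteq> 1" using d(2)[of 1] a by auto
  with d(1) have d2: "d \<ge> 2" by linarith
  have "\<exists>w :: complex. w ^ d = 1 \<and> w \<noteq> 1"
  proof (rule ccontr)
    assume "\<not> ?thesis"
    then have "{w :: complex. w ^ d = 1} \<subseteq> {1}" by auto
    then have "card {w :: complex. w ^ d = 1} \<le> card {1 :: complex}" by (intro card_mono) auto
    with card_roots_unity_eq[of d] d2 show False by simp
  qed
  then obtain w :: complex where w: "w ^ d = 1" "w \<noteq> 1" by blast
  then have w0: "w \<noteq> 0" using d2 by (auto simp: power_0_left)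
  have c: "character (G\<lparr>carrier := {\<one>}\<rparr>) (\<lambda>_. 1)" by (simp add: character_def)
  obtain H' \<chi>' where H': "subgroup H' G" "character (G\<lparr>carrier := H'\<rparr>) \<chi>'" "a \<in> H'" "\<chi>' a = w"
    using extend_character_by_element[OF fin triv c a(1) d(2) _ w0] w by metis
  then obtain \<chi> where "character G \<chi>" "\<forall>x\<in>H'. \<chi> x = \<chi>' x" using extend_character[OF fin] by blast
  with H' w show ?thesis by (intro that[of \<chi>]) auto
qed

section \<open>Values of characters, the dual group and orthogonality\<close>

lemma (in group) character_root_of_unity:
  assumes "character G \<chi>" "x \<in> carrier G"
  shows "\<chi> x ^ Coset.order G = 1"
  using character_pow[OF is_monoid assms, of "Coset.order G"] pow_order_eq_1[OF assms(2)]
  by (simp add: character_one[OF assms(1)])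

lemma (in group) character_norm:
  assumes "finite (carrier G)" "character G \<chi>" "x \<in> carrier G"
  shows "cmod (\<chi> x) = 1"
proof -
  have "Coset.order G > 0" using assms(1) order_gt_0_iff_finite by blast
  moreover have "cmod (\<chi> x) ^ Coset.order G = cmod (\<chi> x ^ Coset.order G)" by (rule norm_power[symmetric])
  then have "cmod (\<chi> x) ^ Coset.order G = 1"
    by (simp add: character_root_of_unity[OF assms(2,3)])
  ultimately show ?thesis using power_eq_imp_eq_base[of "cmod (\<chi> x)" "Coset.order G" 1] by simp
qed

lemma (in group) character_inv:
  assumes "finite (carrier G)" "character G \<chi>" "x \<in> carrier G"
  shows "\<chi> (inv x) = cnj (\<chi> x)"
proof -
  have "\<chi> x * \<chi> (inv x) = 1"
    using character_mult[OF assms(2,3), of "inv x"] assms(3) by (simp add: character_one[OF assms(2)])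
  moreover have "\<chi> x * cnj (\<chi> x) = 1"
    using character_norm[OF assms] by (simp add: complex_norm_square[symmetric])
  ultimately show ?thesis by (metis mult_cancel_left mult_zero_left zero_neq_one)
qed

text \<open>Fixing the values off the carrier leaves one function for each character of the group,
  so the set is finite and can be summed over.\<close>

definition dual :: "('a, 'b) monoid_scheme \<Rightarrow> ('a \<Rightarrow> complex) set" where
  "dual G = {\<chi>. character G \<chi> \<and> \<chi> \<in> extensional (carrier G)}"

lemma (in group) finite_dual:
  assumes "finite (carrier G)"
  shows "finite (dual G)"
proof -
  have "Coset.order G > 0" using assms order_gt_0_iff_finite by blast
  then have "finite (PiE (carrier G) (\<lambda>_. {z :: complex. z ^ Coset.order G = 1}))"
    using assms by (intro finite_PiE finite_roots_unity) auto
  moreover have "dual G \<subseteq> PiE (carrier G) (\<lambda>_. {z :: complex. z ^ Coset.order G = 1})"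
    using character_root_of_unity by (auto simp: dual_def PiE_def)
  ultimately show ?thesis by (rule rev_finite_subset)
qed

lemma (in group) sum_character:
  assumes "character G \<chi>" "a \<in> carrier G" "\<chi> a \<noteq> 1"
  shows "(\<Sum>x\<in>carrier G. \<chi> x) = 0"
proof -
  have "(\<Sum>x\<in>carrier G. \<chi> x) = (\<Sum>x\<in>carrier G. \<chi> (a \<otimes> x))"
    using assms(2)
    by (intro sum.reindex_bij_witness[of _ "\<lambda>x. a \<otimes> x" "\<lambda>x. inv a \<otimes> x"])
       (auto simp: m_assoc[symmetric])
  also have "\<dots> = \<chi> a * (\<Sum>x\<in>carrier G. \<chi> x)"
    using assms by (simp add: character_mult sum_distrib_left)
  finally show ?thesis using assms(3) by auto
qed

text \<open>Multiplication by a character \<open>\<psi>\<close> with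
  \<open>\<psi> a \<noteq> 1\<close> permutes the dual and scales the sum by
  \<open>\<psi> a\<close>. The inverse permutation multiplies by the conjugate, because values have
  norm 1.\<close>

lemma (in comm_group) sum_dual:
  assumes fin: "finite (carrier G)" and a: "a \<in> carrier G" "a \<noteq> \<one>"
  shows "(\<Sum>\<chi>\<in>dual G. \<chi> a) = 0"
proof -
  obtain \<psi> where \<psi>: "character G \<psi>" "\<psi> a \<noteq> 1"
    using characters_separate_points[OF fin a] by blast
  have n: "\<psi> x * cnj (\<psi> x) = 1" if "x \<in> carrier G" for x
    using character_norm[OF fin \<psi>(1) that] by (simp add: complex_norm_square[symmetric])
  then have n': "cnj (\<psi> x) * \<psi> x = 1" if "x \<in> carrier G" for x
    using that by (simp add: mult.commute)
  have cc: "character G (\<lambda>x. cnj (\<psi> x))" using \<psi>(1) by (simp add: character_def)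
  have r: "restrict \<chi> (carrier G) \<in> dual G" if "character G \<chi>" for \<chi>
    using that by (auto simp: dual_def character_def)
  have "(\<Sum>\<chi>\<in>dual G. \<chi> a) = (\<Sum>\<chi>\<in>dual G. \<psi> a * \<chi> a)"
  proof (rule sum.reindex_bij_witness[of _ "\<lambda>\<chi>. restrict (\<lambda>x. \<psi> x * \<chi> x) (carrier G)"
        "\<lambda>\<chi>. restrict (\<lambda>x. cnj (\<psi> x) * \<chi> x) (carrier G)"])
    fix \<chi> assume \<chi>: "\<chi> \<in> dual G"
    from \<chi> have \<chi>': "character G \<chi>" by (simp add: dual_def)
    show "restrict (\<lambda>x. \<psi> x * \<chi> x) (carrier G) \<in> dual G"
      by (rule r[OF character_times[OF \<psi>(1) \<chi>']])
    show "restrict (\<lambda>x. cnj (\<psi> x) * \<chi> x) (carrier G) \<in> dual G"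
      by (rule r[OF character_times[OF cc \<chi>']])
    have out: "\<chi> x = undefined" if "x \<notin> carrier G" for x
      using \<chi> that unfolding dual_def extensional_def by blast
    have e: "\<psi> x * (cnj (\<psi> x) * \<chi> x) = \<chi> x" "cnj (\<psi> x) * (\<psi> x * \<chi> x) = \<chi> x"
      if "x \<in> carrier G" for x
      using n[OF that] n'[OF that] by (metis mult.assoc mult_1)+
    show "restrict (\<lambda>x. \<psi> x * restrict (\<lambda>x. cnj (\<psi> x) * \<chi> x) (carrier G) x) (carrier G) = \<chi>"
    proof
      fix x show "restrict (\<lambda>x. \<psi> x * restrict (\<lambda>x. cnj (\<psi> x) * \<chi> x) (carrier G) x) (carrier G) x = \<chi> x"
        by (cases "x \<in> carrier G") (simp_all only: restrict_apply e if_True if_False not_False_eq_True out)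
    qed
    show "restrict (\<lambda>x. cnj (\<psi> x) * restrict (\<lambda>x. \<psi> x * \<chi> x) (carrier G) x) (carrier G) = \<chi>"
    proof
      fix x show "restrict (\<lambda>x. cnj (\<psi> x) * restrict (\<lambda>x. \<psi> x * \<chi> x) (carrier G) x) (carrier G) x = \<chi> x"
        by (cases "x \<in> carrier G") (simp_all only: restrict_apply e if_True if_False not_False_eq_True out)
    qed
    show "\<psi> a * restrict (\<lambda>x. cnj (\<psi> x) * \<chi> x) (carrier G) a = \<chi> a"
      using a e by simp
  qed
  also have "\<dots> = \<psi> a * (\<Sum>\<chi>\<in>dual G. \<chi> a)" by (simp add: sum_distrib_left)
  finally show ?thesis using \<psi>(2) by auto
qed

section \<open>Characters of prime power order\<close>

lemma (in group) eq_one_if_coprime_powers: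
  assumes "x \<in> carrier G" "x [^] (a :: nat) = \<one>" "x [^] (b :: nat) = \<one>" "coprime a b"
  shows "x = \<one>"
proof -
  have "ord x dvd a" "ord x dvd b" using assms pow_eq_id by blast+
  with assms(4) have "ord x = 1" by (metis coprime_common_divisor_nat)
  with assms(1) pow_ord_eq_1[of x] show ?thesis by simp
qed

lemma (in group) subgroup_pow_card:
  assumes H: "subgroup H G" "x \<in> H"
  shows "x [^] card H = \<one>"
proof -
  interpret H: group "G\<lparr>carrier := H\<rparr>" by (rule subgroup_imp_group[OF H(1)])
  have "x [^]\<^bsub>G\<lparr>carrier := H\<rparr>\<^esub> Coset.order (G\<lparr>carrier := H\<rparr>) = \<one>\<^bsub>G\<lparr>carrier := H\<rparr>\<^esub>"
    using H(2) by (intro H.pow_order_eq_1) simp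
  then show ?thesis by (simp add: Coset.order_def nat_pow_def)
qed

text \<open>A Sylow subgroup supplies \<open>a \<noteq> \<one>\<close> of \<open>r\<close>-power
  order, so \<open>a [^] s \<noteq> \<one>\<close>. The \<open>s\<close>-th power of a character
  separating \<open>a [^] s\<close> from \<open>\<one>\<close> is as required.\<close>

lemma (in comm_group) prime_power_character_exists:
  assumes fin: "finite (carrier G)" and ord: "Coset.order G = r ^ e * s"
    and r: "Factorial_Ring.prime r" and e: "e > 0" and cop: "coprime r s"
  obtains \<chi> a where "character G \<chi>" "\<And>z. z \<in> carrier G \<Longrightarrow> \<chi> z ^ (r ^ e) = 1"
    "a \<in> carrier G" "\<chi> a \<noteq> 1"
proof -
  obtain H where H: "subgroup H G" "card H = r ^ e"
    using sylow_thm[OF r is_group ord fin] by blast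
  have "r ^ e > 1" using r e by (metis one_less_power prime_gt_1_nat)
  then have "H \<noteq> {\<one>}" using H by auto
  then obtain a where a: "a \<in> H" "a \<noteq> \<one>" using subgroup.one_closed[OF H(1)] by blast
  have aG: "a \<in> carrier G" using a H subgroup.subset by blast
  have "a [^] (r ^ e) = \<one>" using subgroup_pow_card[OF H(1) a(1)] H(2) by simp
  then have as: "a [^] s \<noteq> \<one>"
    using eq_one_if_coprime_powers[OF aG, of "r ^ e" s] a cop by auto
  obtain \<psi> where \<psi>: "character G \<psi>" "\<psi> (a [^] s) \<noteq> 1"
    using characters_separate_points[OF fin _ as] aG by blast
  show ?thesis
  proof (rule that[of "\<lambda>z. \<psi> z ^ s" a])
    show "character G (\<lambda>z. \<psi> z ^ s)" by (rule character_power[OF \<psi>(1)])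
    show "(\<psi> z ^ s) ^ (r ^ e) = 1" if "z \<in> carrier G" for z
      using character_root_of_unity[OF \<psi>(1) that] by (simp add: ord mult.commute flip: power_mult)
    show "\<psi> a ^ s \<noteq> 1" using \<psi> character_pow[OF is_monoid \<psi>(1) aG, of s] by simp
  qed (rule aG)
qed

text \<open>Comparing \<open>count\<close> for \<open>U\<close> and for the whole group eliminates
  \<open>card N\<close> and \<open>card (dual G)\<close> and leaves
  \<open>card U * card T = r ^ e * (s * card (U \<inter> T))\<close>. The torsion subgroup
  \<open>T\<close> has order prime to \<open>r\<close>.\<close>

lemma (in comm_group) prime_power_dvd_card_if_character_sums_vanish:
  assumes fin: "finite (carrier G)" and ord: "Coset.order G = r ^ e * s"
    and r: "Factorial_Ring.prime r" and cop: "coprime r s" and U: "U \<subseteq> carrier G"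
    and van: "\<And>\<chi> a. character G \<chi> \<Longrightarrow> (\<And>z. z \<in> carrier G \<Longrightarrow> \<chi> z ^ (r ^ e) = 1) \<Longrightarrow>
      a \<in> carrier G \<Longrightarrow> \<chi> a \<noteq> 1 \<Longrightarrow> (\<Sum>x\<in>U. \<chi> x) = 0"
  shows "r ^ e dvd card U"
proof -
  define T where "T = {g \<in> carrier G. g [^] s = \<one>}"
  define N where "N = {\<chi> \<in> dual G. \<forall>z\<in>carrier G. \<chi> z ^ s = 1}"
  \<comment> \<open>Both sides count \<open>\<Sum>\<chi> (g ^ s)\<close> over \<open>\<chi> \<in> dual G\<close>, \<open>g \<in> W\<close>.\<close>
  have count: "card N * card W = card (dual G) * card (W \<inter> T)"
    if W: "W \<subseteq> carrier G"
      and van: "\<And>\<chi>. character G \<chi> \<Longrightarrow> (\<And>z. z \<in> carrier G \<Longrightarrow> \<chi> z ^ (r ^ e) = 1) \<Longrightarrow>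
        (\<exists>a\<in>carrier G. \<chi> a \<noteq> 1) \<Longrightarrow> (\<Sum>x\<in>W. \<chi> x) = 0" for W
  proof -
    have finW: "finite W" using W fin finite_subset by blast
    have "(\<Sum>\<chi>\<in>dual G. \<Sum>g\<in>W. \<chi> g ^ s) = (\<Sum>\<chi>\<in>dual G. if \<chi> \<in> N then of_nat (card W) else 0)"
    proof (intro sum.cong refl)
      fix \<chi> assume \<chi>: "\<chi> \<in> dual G"
      then have c: "character G \<chi>" by (simp add: dual_def)
      show "(\<Sum>g\<in>W. \<chi> g ^ s) = (if \<chi> \<in> N then of_nat (card W) else 0)"
      proof (cases "\<chi> \<in> N")
        case True
        then have "(\<Sum>g\<in>W. \<chi> g ^ s) = (\<Sum>g\<in>W. 1)"
          using W by (intro sum.cong) (auto simp: N_def)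
        with True show ?thesis by simp
      next
        case False
        then have "\<exists>a\<in>carrier G. \<chi> a ^ s \<noteq> 1" using \<chi> by (auto simp: N_def)
        \<comment> \<open>So the \<open>s\<close>-th power of \<open>\<chi>\<close> is a nontrivial
          character of the kind covered by \<open>van\<close>.\<close>
        moreover have "(\<chi> z ^ s) ^ (r ^ e) = 1" if "z \<in> carrier G" for z
          using character_root_of_unity[OF c that] by (simp add: ord mult.commute flip: power_mult)
        ultimately have "(\<Sum>g\<in>W. \<chi> g ^ s) = 0"
          by (intro van character_power[OF c])
        with False show ?thesis by simp
      qed
    qed
    also have "\<dots> = of_nat (card N * card W)"
      using finite_dual[OF fin] by (simp add: sum.If_cases N_def Int_def)
    finally have 1: "(\<Sum>\<chi>\<in>dual G. \<Sum>g\<in>W. \<chi> g ^ s) = of_nat (card N * card W)" .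
    have "(\<Sum>\<chi>\<in>dual G. \<Sum>g\<in>W. \<chi> g ^ s) = (\<Sum>g\<in>W. \<Sum>\<chi>\<in>dual G. \<chi> (g [^] s))"
      using W character_pow[OF is_monoid]
      by (subst sum.swap) (intro sum.cong refl, auto simp: dual_def subset_iff)
    also have "\<dots> = (\<Sum>g\<in>W. if g \<in> T then of_nat (card (dual G)) else 0)"
    proof (intro sum.cong refl)
      fix g assume "g \<in> W"
      then have g: "g \<in> carrier G" using W by blast
      show "(\<Sum>\<chi>\<in>dual G. \<chi> (g [^] s)) = (if g \<in> T then of_nat (card (dual G)) else 0)"
      proof (cases "g \<in> T")
        case True
        then have "(\<Sum>\<chi>\<in>dual G. \<chi> (g [^] s)) = (\<Sum>\<chi>\<in>dual G. 1)"
          by (intro sum.cong) (auto simp: T_def dual_def character_one)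
        with True show ?thesis by simp
      next
        case False
        with g sum_dual[OF fin, of "g [^] s"] show ?thesis by (simp add: T_def)
      qed
    qed
    also have "\<dots> = of_nat (card (dual G) * card (W \<inter> T))"
      using finW by (simp add: sum.If_cases Int_def)
    finally have "(of_nat (card N * card W) :: complex) = of_nat (card (dual G) * card (W \<inter> T))"
      using 1 by simp
    then show ?thesis by (simp only: of_nat_eq_iff)
  qed
  have A: "card N * card U = card (dual G) * card (U \<inter> T)"
    using van by (intro count U) blast
  have TG: "carrier G \<inter> T = T" by (auto simp: T_def)
  have "card N * card (carrier G) = card (dual G) * card T"
    using count[of "carrier G"] sum_character unfolding TG by blast
  then have B: "card N * (r ^ e * s) = card (dual G) * card T"
    using ord by (simp add: Coset.order_def)
  have "restrict (\<lambda>_. 1) (carrier G) \<in> N"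
    by (auto simp: N_def dual_def character_def)
  moreover have "finite N" using finite_dual[OF fin] by (simp add: N_def)
  ultimately have N: "card N > 0" by (auto simp: card_gt_0_iff)
  have "card N * (card U * card T) = card N * (r ^ e * s * card (U \<inter> T))"
    using A B by (metis (no_types, lifting) mult.assoc mult.commute)
  with N have "card U * card T = r ^ e * (s * card (U \<inter> T))" by (simp add: mult.assoc)
  then have dvd: "r ^ e dvd card U * card T" by simp
  have subT: "subgroup T G"
    by (rule subgroupI) (auto simp: T_def nat_pow_inv pow_mult_distrib m_comm intro!: exI[of _ \<one>])
  \<comment> \<open>Otherwise Cauchy's theorem (Sylow with exponent 1) gives an element of
    \<open>T\<close> other than \<open>\<one>\<close> that is killed by both \<open>r\<close> and
    \<open>s\<close>.\<close>
  have "\<not> r dvd card T"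
  proof
    assume "r dvd card T"
    then obtain c where c: "card T = r ^ 1 * c" by auto
    have "finite T" using fin by (simp add: T_def)
    then obtain H where H: "subgroup H (G\<lparr>carrier := T\<rparr>)" "card H = r ^ 1"
      using sylow_thm[OF r subgroup_imp_group[OF subT], of 1 c] c by (auto simp: Coset.order_def)
    have HG: "subgroup H G" using H(1) subT incl_subgroup by blast
    have "card H > 1" using H(2) r prime_gt_1_nat by simp
    then have "H \<noteq> {\<one>}" by auto
    then obtain h where h: "h \<in> H" "h \<noteq> \<one>" using subgroup.one_closed[OF HG] by blast
    have "h \<in> T" using h H(1) subgroup.subset by fastforce
    then have "h \<in> carrier G" "h [^] s = \<one>" by (auto simp: T_def)
    moreover have "h [^] r = \<one>" using subgroup_pow_card[OF HG h(1)] H(2) by simp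
    ultimately show False using eq_one_if_coprime_powers[of h r s] cop h by blast
  qed
  then have "coprime (r ^ e) (card T)" using r by (simp add: prime_imp_coprime)
  with dvd show ?thesis by (simp add: coprime_dvd_mult_left_iff)
qed

section \<open>Arithmetic of the parameters\<close>

text \<open>From \<open>(x - 1) * (y - 1) \<ge> 0\<close>. With \<open>l = n * x * y\<close> it
  bounds every divisor of \<open>x + y\<close> by \<open>l + 1\<close>, hence by
  \<open>k\<close>.\<close>

lemma le_Suc_mult_if_dvd_add:
  fixes x y n s :: nat
  assumes "x > 0" "y > 0" "n > 0" "s dvd x + y"
  shows "s \<le> n * x * y + 1"
proof -
  have "s \<le> x + y" using assms by (intro dvd_imp_le) auto
  also have "x + y \<le> x * y + 1"
    using assms(1,2) by (cases x; cases y) auto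
  also have "x * y \<le> n * (x * y)" using assms(3) by (cases n) auto
  finally show ?thesis by (simp add: mult.assoc)
qed

text \<open>With \<open>k = p * k'\<close>, \<open>l = p ^ 2 * l'\<close> and
  \<open>m = q * c + 2\<close> the equation yields \<open>q * e = l' + k' ^ 2\<close> and
  \<open>e + q * c * e = c * l' + q * p * l'\<close>. As \<open>e\<close> and \<open>c * l'\<close>
  are below \<open>q\<close>, comparing residues and quotients gives \<open>e = c * l'\<close> and
  \<open>c * e = p * l'\<close>, so the prime \<open>p\<close> would be the square of
  \<open>c\<close>.\<close>

lemma no_parameters_p_dvd_k:
  fixes p q m k l :: nat
  assumes p: "Factorial_Ring.prime p" and q: "q > 0" and m: "m > 2"
    and eq: "k ^ 2 * (m - 1) = l * (p * q ^ 2 - 1)" and km: "k * m < p * q ^ 2"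
    and l: "0 < l" "l < k" and pk: "p dvd k" and qm: "q dvd m - 2"
  shows False
proof -
  have p0: "p > 0" and p2: "p \<ge> 2" using p prime_gt_0_nat prime_ge_2_nat by auto
  obtain k' where k': "k = p * k'" using pk by blast
  obtain c where "m - 2 = q * c" using qm by blast
  then have c: "m = q * c + 2" and c0: "c > 0" using m by (auto intro: gr0I)
  have pq0: "p * q ^ 2 > 0" using p0 q by simp
  have "coprime (p ^ 2) (p * q ^ 2 - 1)"
  proof -
    have "coprime (p * q ^ 2) (p * q ^ 2 - 1)"
      by (rule coprime_diff_one_right_nat[OF pq0])
    then show ?thesis by simp
  qed
  moreover have "p ^ 2 dvd l * (p * q ^ 2 - 1)"
    unfolding eq[symmetric] k' power_mult_distrib mult.assoc by (rule dvd_triv_left)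
  ultimately have "p ^ 2 dvd l" by (metis coprime_dvd_mult_left_iff)
  then obtain l' where l': "l = p ^ 2 * l'" by blast
  have "p ^ 2 * (k' ^ 2 * (m - 1)) = p ^ 2 * (l' * (p * q ^ 2 - 1))"
    using eq by (simp add: k' l' power_mult_distrib mult_ac)
  then have l'v: "k' ^ 2 * (m - 1) = l' * (p * q ^ 2 - 1)" using p0 by simp
  have "p * q ^ 2 = (p * q ^ 2 - 1) + 1" using pq0 by simp
  then have "l' * (p * q ^ 2) = l' * (p * q ^ 2 - 1) + l'"
    by (metis distrib_left mult.right_neutral)
  moreover have "m - 1 = q * c + 1" using c by simp
  ultimately have main: "l' * (p * q ^ 2) = l' + k' ^ 2 * (q * c + 1)"
    by (metis l'v add.commute)
  have l'0: "l' > 0" using l(1) l' by (auto intro: gr0I)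
  \<comment> \<open>The size bounds that follow come from \<open>l < k\<close> and
    \<open>k * m < p * q ^ 2\<close>; they serve to identify residues modulo
    \<open>q\<close>.\<close>
  have "p * (p * l') < p * k'" using l(2) l' k' by (simp add: power2_eq_square mult.assoc)
  then have pl': "p * l' < k'" by simp
  have "p * (k' * m) < p * q ^ 2" using km k' by (simp add: mult.assoc)
  then have k'm: "k' * (q * c + 2) < q * q" using c by (simp add: power2_eq_square)
  moreover have "k' * (q * c + 2) = q * (k' * c) + 2 * k'" by (simp add: algebra_simps)
  ultimately have "q * (k' * c) < q * q" by linarith
  then have k'c: "k' * c < q" by simp
  have "k' * 1 \<le> k' * c" using c0 by (intro mult_le_mono2) simp
  then have k'q: "k' < q" using k'c unfolding mult_1_right by linarith
  have "1 * l' \<le> p * l'" using p0 by (intro mult_le_mono1) simp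
  then have l'k': "l' < k'" using pl' unfolding mult_1 by linarith
  have "l' + k' ^ 2 + q * (k' ^ 2 * c) = q * (l' * p * q)"
    using main by (simp add: algebra_simps power2_eq_square)
  then have "q dvd l' + k' ^ 2" by (metis dvd_add_left_iff dvd_triv_left)
  then obtain e where e: "l' + k' ^ 2 = q * e" by blast
  have "q * (e + k' ^ 2 * c) = q * (l' * p * q)"
    using main e by (simp add: algebra_simps power2_eq_square)
  then have e2: "e + k' ^ 2 * c = l' * p * q" using q by simp
  have "(l' + k' ^ 2) * c = q * e * c" by (simp only: e)
  then have "e + k' ^ 2 * c + l' * c = e + q * e * c" by (simp add: algebra_simps)
  then have e3: "e + q * (c * e) = c * l' + q * (p * l')" using e2 by (simp add: algebra_simps)
  have "q * e < k' + k' ^ 2" using e l'k' by simp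
  also have "\<dots> = k' * (k' + 1)" by (simp add: power2_eq_square)
  also have "\<dots> \<le> q * q" using k'q by (intro mult_le_mono) auto
  finally have eq: "e < q" by simp
  have "l' * c \<le> k' * c" using l'k' by (intro mult_le_mono1) simp
  then have "c * l' < q" using k'c unfolding mult.commute[of c l'] by linarith
  then have el: "e = c * l'" using e3 eq by (metis mod_less mod_mult_self2)
  then have "c * e = p * l'" using e3 q by simp
  then have "p = c * c" using el l'0 by simp
  then show False using p by (metis prime_product nat_mult_1 not_prime_1)
qed

text \<open>Put \<open>g * x + 1 = p * \<alpha>\<close>, \<open>g * y + 1 = p * \<beta>\<close> and
  \<open>x + y = q * w\<close>. Size bounds force \<open>\<alpha> = n = w = 1\<close>. Then
  \<open>m - 1\<close> divides \<open>(p - 1) * (p - g ^ 2)\<close>, and reducing the quotient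
  modulo \<open>p\<close> or modulo \<open>g\<close> makes it too large in absolute value.\<close>

lemma no_parameters_p_dvd_m:
  fixes p q m k l g x y n :: nat
  assumes p: "Factorial_Ring.prime p" "odd p" and q: "q > 0"
    and xy: "coprime x y" "0 < x" "x < y" and g: "g > 0" "g * (x + y) + 2 = m" and n: "n > 0" "l = n * x * y"
    and eq: "k ^ 2 * (m - 1) = l * (p * q ^ 2 - 1)" and km: "k * m < p * q ^ 2" and l: "l < k"
    and pm: "p dvd m" and qs: "q dvd x + y" and pd: "p dvd y - x"
  shows False
proof -
  have "p \<noteq> 2" using p(2) by auto
  then have p3: "p \<ge> 3" and p0: "p > 0" using prime_ge_2_nat[OF p(1)] by linarith+
  obtain m' where m': "m = p * m'" using pm by blast
  have "2 * (g * x + 1) + g * (y - x) = m" using g xy by (simp add: algebra_simps diff_mult_distrib2)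
  then have "p dvd 2 * (g * x + 1)" using pm pd by (metis dvd_add_left_iff dvd_mult)
  moreover have "coprime p 2" using p(2) by simp
  ultimately have "p dvd g * x + 1" by (simp add: coprime_dvd_mult_right_iff del: mult_Suc_right)
  then obtain \<alpha> where \<alpha>: "g * x + 1 = p * \<alpha>" by blast
  have "(g * x + 1) + (g * y + 1) = m" using g by (simp add: algebra_simps)
  then have "p dvd g * y + 1" using pm \<open>p dvd g * x + 1\<close> by (metis dvd_add_right_iff)
  then obtain \<beta> where \<beta>: "g * y + 1 = p * \<beta>" by blast
  have m\<alpha>\<beta>: "m' = \<alpha> + \<beta>"
  proof -
    have "p * m' = p * (\<alpha> + \<beta>)" using \<alpha> \<beta> \<open>(g * x + 1) + (g * y + 1) = m\<close> m'
      by (simp add: distrib_left)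
    then show ?thesis using p0 by simp
  qed
  have \<alpha>0: "\<alpha> \<ge> 1" using \<alpha> by (cases \<alpha>) auto
  have "p * \<alpha> < p * \<beta>" using xy g by (simp flip: \<alpha> \<beta>)
  then have \<alpha>\<beta>: "\<alpha> < \<beta>" by simp
  obtain w where w: "x + y = q * w" using qs by blast
  have w0: "w > 0" using w xy by (auto intro: gr0I)
  have gqw: "g * q * w + 2 = p * m'" using g w m' by (simp add: mult.assoc)
  have "p * (l * m') \<le> k * m" using l m' by simp
  then have "p * (l * m') < p * q ^ 2" using km by linarith
  then have lm: "l * m' < q ^ 2" by simp
  define P \<A> \<B> W G where "P = int p" and "\<A> = int \<alpha>" and "\<B> = int \<beta>" and "W = int (n * w ^ 2)" and "G = int g"
  have "n * w ^ 2 \<ge> 1" using n(1) w0 by (simp add: Suc_le_eq)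
  then have P3: "P \<ge> 3" and A1: "\<A> \<ge> 1" and AB: "\<A> + 1 \<le> \<B>" and W1: "W \<ge> 1" and G1: "G \<ge> 1"
    using p3 \<alpha>0 \<alpha>\<beta> g(1) unfolding P_def \<A>_def \<B>_def W_def G_def by linarith+
  have "int (g * x + 1) = int (p * \<alpha>)" "int (g * y + 1) = int (p * \<beta>)"
    using \<alpha> \<beta> by simp_all
  then have gx: "G * int x = P * \<A> - 1" and gy: "G * int y = P * \<B> - 1"
    unfolding G_def P_def \<A>_def \<B>_def by simp_all
  have gw: "G * int q * int w = P * (\<A> + \<B>) - 2"
    using gqw m\<alpha>\<beta> by (simp add: G_def P_def \<A>_def \<B>_def flip: of_nat_mult of_nat_add)
  have "int l * (\<A> + \<B>) < int q ^ 2"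
    using lm m\<alpha>\<beta> by (simp add: \<A>_def \<B>_def flip: of_nat_mult of_nat_add of_nat_power)
  \<comment> \<open>The factor \<open>(G * int w) ^ 2\<close> allows \<open>x\<close>,
    \<open>y\<close> and \<open>q\<close> to be eliminated through \<open>gx\<close>,
    \<open>gy\<close> and \<open>gw\<close>.\<close>
  then have "(G * int w) ^ 2 * (int l * (\<A> + \<B>)) < (G * int w) ^ 2 * int q ^ 2"
    using G1 w0 by (intro mult_strict_left_mono) auto
  moreover have "(G * int w) ^ 2 * int q ^ 2 = (P * (\<A> + \<B>) - 2) ^ 2"
    by (simp add: power_mult_distrib mult_ac flip: gw)
  moreover have "(G * int w) ^ 2 * (int l * (\<A> + \<B>)) = W * ((P * \<A> - 1) * (P * \<B> - 1)) * (\<A> + \<B>)"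
    unfolding gx[symmetric] gy[symmetric] W_def n(2) by (simp add: power2_eq_square mult_ac)
  ultimately have main: "W * ((P * \<A> - 1) * (P * \<B> - 1)) * (\<A> + \<B>) < (P * (\<A> + \<B>) - 2) ^ 2"
    by simp
  have pos: "(P * \<A> - 1) * (P * \<B> - 1) \<ge> 0"
    using P3 A1 AB by (intro mult_nonneg_nonneg) (simp_all add: mult_ge1_I)
  have "\<A> = 1"
  proof (rule ccontr)
    assume "\<A> \<noteq> 1"
    then have A2: "\<A> \<ge> 2" using A1 by simp
    define u where "u = \<A> + \<B> - 4"
    have u: "u \<ge> 0" using A2 AB by (simp add: u_def)
    \<comment> \<open>For a fixed sum, the product of two numbers that are at least 2 is smallest
      when one of them is 2; this bounds the left side of \<open>main\<close> below in terms of
      \<open>u\<close>.\<close>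
    have "(\<A> - 2) * (\<B> - 2) \<ge> 0" using A2 AB by (intro mult_nonneg_nonneg) auto
    then have ab: "\<A> * \<B> \<ge> 2 * u + 4" by (simp add: u_def algebra_simps)
    have "(P * \<A> - 1) * (P * \<B> - 1) = P ^ 2 * (\<A> * \<B>) - P * (u + 4) + 1"
      by (simp add: u_def power2_eq_square algebra_simps)
    also have "\<dots> \<ge> P ^ 2 * (2 * u + 4) - P * (u + 4) + 1"
      using ab by (simp add: mult_left_mono)
    finally have "(P ^ 2 * (2 * u + 4) - P * (u + 4) + 1) * (u + 4) \<le> (P * \<A> - 1) * (P * \<B> - 1) * (u + 4)"
      using u by (intro mult_right_mono) auto
    also have "\<dots> \<le> W * ((P * \<A> - 1) * (P * \<B> - 1)) * (u + 4)"
      using pos u W1 by (intro mult_right_mono) (auto simp: mult_le_cancel_right1)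
    also have "\<dots> < (P * (u + 4) - 2) ^ 2" using main by (simp add: u_def)
    finally have "(P ^ 2 * (2 * u + 4) - P * (u + 4) + 1) * (u + 4) < (P * (u + 4) - 2) ^ 2" .
    then have "P * (P - 1) * (u + 4) * u + u < 0" by (simp add: power2_eq_square algebra_simps)
    moreover have "P * (P - 1) * (u + 4) * u \<ge> 0" using P3 u by simp
    ultimately show False using u by simp
  qed
  have "W = 1"
  proof (rule ccontr)
    assume "W \<noteq> 1"
    then have W2: "W \<ge> 2" using W1 by simp
    have "2 * ((P - 1) * (P * \<B> - 1)) * (1 + \<B>) \<le> W * ((P - 1) * (P * \<B> - 1)) * (1 + \<B>)"
      using W2 pos AB \<open>\<A> = 1\<close> by (intro mult_right_mono) auto
    then have "2 * ((P - 1) * (P * \<B> - 1)) * (1 + \<B>) < (P * (1 + \<B>) - 2) ^ 2"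
      using main \<open>\<A> = 1\<close> by simp
    then have "P * (P - 2) * (\<B> + 1) * (\<B> - 1) + 2 * (\<B> - 1) < 0"
      by (simp add: power2_eq_square algebra_simps)
    moreover have "P * (P - 2) * (\<B> + 1) * (\<B> - 1) \<ge> 0"
      using P3 AB \<open>\<A> = 1\<close> by (intro mult_nonneg_nonneg) auto
    ultimately show False using AB \<open>\<A> = 1\<close> by simp
  qed
  then have nw: "n = 1" "w = 1" by (auto simp: W_def nat_mult_eq_1_iff simp flip: of_nat_mult of_nat_power)
  define M Q where "M = P * (1 + \<B>) - 1" and "Q = int q"
  have Gq: "G * Q = M - 1" using gw nw \<open>\<A> = 1\<close> by (simp add: M_def Q_def)
  have Gx: "G * int x = P - 1" using gx \<open>\<A> = 1\<close> by simp
  have Gy: "G * int y = M - P" using gy by (simp add: M_def algebra_simps)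
  have B2: "\<B> \<ge> 2" using AB \<open>\<A> = 1\<close> by simp
  have "P * 3 \<le> P * (1 + \<B>)" using B2 P3 by (intro mult_left_mono) auto
  then have M: "M \<ge> 3 * P - 1" by (simp add: M_def)
  have mM: "int (m - 1) = M" using m' m\<alpha>\<beta> \<open>\<A> = 1\<close> g by (simp add: M_def P_def \<A>_def \<B>_def of_nat_diff algebra_simps)
  have "int (p * q ^ 2 - 1) = P * Q ^ 2 - 1" using p0 q by (simp add: of_nat_diff P_def Q_def)
  then have "int k ^ 2 * M = int x * int y * (P * Q ^ 2 - 1)"
    using arg_cong[OF eq, of int] n(2) nw mM by simp
  \<comment> \<open>Scaling by \<open>G ^ 4\<close> eliminates \<open>x\<close>, \<open>y\<close>
    and \<open>q\<close> and leaves an identity in \<open>M\<close>, \<open>P\<close>,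
    \<open>G\<close> and \<open>k\<close>.\<close>
  then have "G ^ 4 * (int k ^ 2 * M) = G ^ 4 * (int x * int y * (P * Q ^ 2 - 1))" by (simp only:)
  also have "\<dots> = (G * int x) * (G * int y) * (P * (G * Q) ^ 2 - G ^ 2)"
    by (simp add: power2_eq_square power4_eq_xxxx algebra_simps)
  finally have "G ^ 4 * (int k ^ 2 * M) = \<dots>" .
  then have key: "M * (G ^ 4 * int k ^ 2) = (P - 1) * (M - P) * (P * (M - 1) ^ 2 - G ^ 2)"
    by (simp add: Gx Gy Gq mult_ac)
  \<comment> \<open>Expansion that isolates the residue modulo \<open>M\<close>, namely
    \<open>- P * ((P - 1) * (P - G ^ 2))\<close>.\<close>
  have "(P - 1) * (M - P) * (P * (M - 1) ^ 2 - G ^ 2) =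
      M * ((P - 1) * (P * M ^ 2 - 2 * P * M - P * (P * M - 2 * P) + P - G ^ 2)) - P * ((P - 1) * (P - G ^ 2))"
    by (simp add: power2_eq_square algebra_simps)
  then have "P * ((P - 1) * (P - G ^ 2)) =
      M * ((P - 1) * (P * M ^ 2 - 2 * P * M - P * (P * M - 2 * P) + P - G ^ 2) - G ^ 4 * int k ^ 2)"
    using key by (simp add: right_diff_distrib)
  then have "M dvd P * ((P - 1) * (P - G ^ 2))" by simp
  moreover have "coprime M P"
  proof (rule coprimeI)
    fix c assume "c dvd M" "c dvd P"
    then have "c dvd P * (1 + \<B>) - M" by simp
    then show "is_unit c" by (simp add: M_def)
  qed
  ultimately have "M dvd (P - 1) * (P - G ^ 2)" by (simp add: coprime_dvd_mult_right_iff)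
  then obtain h where h: "(P - 1) * (P - G ^ 2) = M * h" by blast
  have "P \<noteq> G ^ 2"
  proof
    assume "P = G ^ 2"
    then have "p = g * g" by (simp add: P_def G_def power2_eq_square flip: of_nat_mult)
    then show False using p(1) by (metis prime_product nat_mult_1 not_prime_1)
  qed
  then consider "G ^ 2 < P" | "P < G ^ 2" by linarith
  then show False
  proof cases
    case 1
    then have "M * h > 0" using P3 by (simp flip: h)
    then have h0: "h > 0" using M P3 by (simp add: zero_less_mult_iff)
    \<comment> \<open>Reduction modulo \<open>P\<close>, where \<open>M\<close> is congruent to -1.
      The resulting bound \<open>h \<ge> P - G ^ 2\<close> forces
      \<open>M \<le> P - 1\<close>.\<close>
    have "G ^ 2 + h = P * ((1 + \<B>) * h - P + G ^ 2 + 1)"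
      using h by (simp add: M_def algebra_simps power2_eq_square)
    then have "P dvd G ^ 2 + h" by simp
    then have "P \<le> G ^ 2 + h" using h0 by (intro zdvd_imp_le) (auto intro: add_nonneg_pos)
    then have "M * (P - G ^ 2) \<le> M * h" using M P3 by (intro mult_left_mono) auto
    also have "\<dots> = (P - 1) * (P - G ^ 2)" by (rule h[symmetric])
    finally have "M \<le> P - 1" using 1 by (simp add: mult_le_cancel_right)
    with M P3 show False by simp
  next
    case 2
    then have "M * (- h) > 0" using P3 by (simp add: mult_pos_neg flip: h)
    then have h0: "- h > 0" using M P3 by (simp add: zero_less_mult_iff mult_less_0_iff)
    \<comment> \<open>Reduction modulo \<open>G\<close>, where \<open>M\<close> is congruent to 1
      and \<open>P - 1\<close> to 0.\<close>
    have "- h = G * (int x * (G ^ 2 - P) - Q * (- h))"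
    proof -
      have "(G * Q + 1) * (- h) = - (M * h)" by (simp add: Gq)
      also have "\<dots> = (P - 1) * (G ^ 2 - P)" by (simp add: algebra_simps flip: h)
      finally have "(G * Q + 1) * (- h) = G * int x * (G ^ 2 - P)" by (simp only: Gx)
      then show ?thesis by (simp add: algebra_simps)
    qed
    then have "G dvd - h" by (rule dvdI)
    then have "G \<le> - h" using h0 by (intro zdvd_imp_le)
    then have "M * G \<le> M * (- h)" using M P3 by (intro mult_left_mono) auto
    also have "\<dots> = (P - 1) * (G ^ 2 - P)" using h by (simp add: algebra_simps)
    also have "\<dots> \<le> (P - 1) * G ^ 2" using P3 by (intro mult_left_mono) auto
    finally have "M * G \<le> ((P - 1) * G) * G" by (simp add: power2_eq_square mult.assoc)
    then have MG: "M \<le> (P - 1) * G" using G1 by (simp add: mult_le_cancel_right)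
    have "G * (int y - int x) = P * (\<B> - 1)" using Gx Gy by (simp add: M_def algebra_simps)
    then have "G dvd P * (\<B> - 1)" by (rule dvdI[OF sym])
    moreover have "coprime G P"
    proof (rule coprimeI)
      fix c assume c: "c dvd G" "c dvd P"
      then have "c dvd G * int x" by simp
      with c have "c dvd P - G * int x" by (intro dvd_diff)
      then show "is_unit c" by (simp add: Gx)
    qed
    ultimately have "G dvd \<B> - 1" by (simp add: coprime_dvd_mult_right_iff)
    then have "G \<le> \<B> - 1" using B2 by (intro zdvd_imp_le) auto
    then have "(P - 1) * G \<le> (P - 1) * (\<B> - 1)" using P3 by (intro mult_left_mono) auto
    with MG have "P * (1 + \<B>) - 1 \<le> (P - 1) * (\<B> - 1)" by (simp add: M_def)
    then have "2 * P + \<B> \<le> 2" by (simp add: algebra_simps)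
    with P3 B2 show False by simp
  qed
qed

section \<open>Character sums of the blocks\<close>

locale sedf_family = comm_group G for G (structure) +
  fixes v m k l :: nat and D :: "nat \<Rightarrow> 'a set"
  assumes sedf: "sedf G v m k l D" and m: "m > 2" and k: "k > 1"
begin

definition S :: "('a \<Rightarrow> complex) \<Rightarrow> nat \<Rightarrow> complex" where
  "S \<chi> j = (\<Sum>x\<in>D j. \<chi> x)"

text \<open>By disjointness this is the character sum over the union of all blocks, see
  \<open>T_eq_sum_Union\<close>.\<close>

definition T :: "('a \<Rightarrow> complex) \<Rightarrow> complex" where
  "T \<chi> = (\<Sum>j\<in>{1..m}. S \<chi> j)"

lemmas sedf_conjs = sedf[unfolded sedf_def]
lemmas fin = sedf_conjs[THEN conjunct2, THEN conjunct1]
lemmas ord = sedf_conjs[THEN conjunct2, THEN conjunct2, THEN conjunct1]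
lemmas l = sedf_conjs[THEN conjunct2, THEN conjunct2, THEN conjunct2, THEN conjunct1]
lemmas disj = sedf_conjs[THEN conjunct2, THEN conjunct2, THEN conjunct2, THEN conjunct2,
  THEN conjunct2, THEN conjunct1]

lemma block:
  assumes "j \<in> {1..m}"
  shows "D j \<subseteq> carrier G" "card (D j) = k" "finite (D j)"
proof -
  show "D j \<subseteq> carrier G" "card (D j) = k"
    using sedf_conjs[THEN conjunct2, THEN conjunct2, THEN conjunct2, THEN conjunct2, THEN conjunct1,
      THEN bspec, OF assms] by simp_all
  then show "finite (D j)" using fin finite_subset by blast
qed

lemma card_differences:
  assumes "j \<in> {1..m}" "g \<in> carrier G - {\<one>}"
  shows "card {(x, y). x \<in> D j \<and> y \<in> (\<Union>i\<in>{1..m} - {j}. D i) \<and> x \<otimes> inv y = g} = l"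
  by (rule sedf_conjs[THEN conjunct2, THEN conjunct2, THEN conjunct2, THEN conjunct2,
      THEN conjunct2, THEN conjunct2, THEN bspec, THEN bspec, OF assms])

lemma v_pos: "v > 0"
  using ord fin order_gt_0_iff_finite by blast

lemma sum_Union:
  assumes "I \<subseteq> {1..m}"
  shows "(\<Sum>x\<in>(\<Union>i\<in>I. D i). f x) = (\<Sum>i\<in>I. \<Sum>x\<in>D i. f x)"
  using assms disj block(3) finite_subset[OF assms]
  by (intro sum.UNION_disjoint) (auto simp: disjoint_family_on_def subset_iff)

text \<open>The image under \<open>\<chi>\<close> of the group ring equation: pairs are grouped by
  \<open>x \<otimes> inv y\<close>, which is never \<open>\<one>\<close> because the blocks are
  disjoint.\<close>

lemma character_equation:
  assumes j: "j \<in> {1..m}" and \<chi>: "character G \<chi>"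
  shows "S \<chi> j * cnj (T \<chi> - S \<chi> j) = of_nat l * (\<Sum>g\<in>carrier G - {\<one>}. \<chi> g)"
proof -
  define U where "U = (\<Union>i\<in>{1..m} - {j}. D i)"
  have UG: "U \<subseteq> carrier G" using block(1) unfolding U_def by blast
  have finU: "finite U" using UG fin finite_subset by blast
  have DU: "x \<noteq> y" if "x \<in> D j" "y \<in> U" for x y
    using that j disj by (fastforce simp: U_def disjoint_family_on_def)
  have U: "(\<Sum>y\<in>U. \<chi> y) = T \<chi> - S \<chi> j"
    using sum_Union[of "{1..m} - {j}" \<chi>] j by (simp add: U_def T_def S_def sum_diff1)
  let ?P = "D j \<times> U" and ?q = "\<lambda>(x, y). x \<otimes> inv y"
  have "S \<chi> j * cnj (T \<chi> - S \<chi> j) = S \<chi> j * cnj (\<Sum>y\<in>U. \<chi> y)"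
    by (simp only: U)
  also have "\<dots> = (\<Sum>x\<in>D j. \<Sum>y\<in>U. \<chi> x * cnj (\<chi> y))"
    by (simp add: S_def sum_product)
  also have "\<dots> = (\<Sum>z\<in>?P. \<chi> (?q z))"
    unfolding sum.cartesian_product
  proof (intro sum.cong refl, clarify)
    fix x y assume "x \<in> D j" "y \<in> U"
    then have "x \<in> carrier G" "y \<in> carrier G" using UG block(1)[OF j] by auto
    then show "\<chi> x * cnj (\<chi> y) = \<chi> (x \<otimes> inv y)"
      using character_inv[OF fin \<chi>] by (simp add: character_mult[OF \<chi>])
  qed
  also have "\<dots> = (\<Sum>g\<in>carrier G - {\<one>}. \<Sum>z\<in>{z \<in> ?P. ?q z = g}. \<chi> (?q z))"
  proof (rule sum.group[symmetric])
    show "?q ` ?P \<subseteq> carrier G - {\<one>}"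
    proof (rule image_subsetI, clarify)
      fix x y assume xy: "x \<in> D j" "y \<in> U"
      then have c: "x \<in> carrier G" "y \<in> carrier G" using UG block(1)[OF j] by auto
      have "x \<otimes> inv y \<noteq> \<one>"
      proof
        assume "x \<otimes> inv y = \<one>"
        then have "x = y" using c by (metis inv_closed inv_equality inv_inv)
        then show False using DU[OF xy] by simp
      qed
      with c show "x \<otimes> inv y \<in> carrier G - {\<one>}" by simp
    qed
  qed (use fin finU block(3)[OF j] in auto)
  also have "\<dots> = (\<Sum>g\<in>carrier G - {\<one>}. of_nat l * \<chi> g)"
  proof (intro sum.cong refl)
    fix g assume g: "g \<in> carrier G - {\<one>}"
    have "{z \<in> ?P. ?q z = g} = {(x, y). x \<in> D j \<and> y \<in> U \<and> x \<otimes> inv y = g}" by auto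
    then have "card {z \<in> ?P. ?q z = g} = l"
      using card_differences[OF j g] by (simp add: U_def)
    then show "(\<Sum>z\<in>{z \<in> ?P. ?q z = g}. \<chi> (?q z)) = of_nat l * \<chi> g" by simp
  qed
  finally show ?thesis by (simp add: sum_distrib_left)
qed

lemma nontrivial_character_equation:
  assumes j: "j \<in> {1..m}" and \<chi>: "character G \<chi>" "a \<in> carrier G" "\<chi> a \<noteq> 1"
  shows "S \<chi> j * cnj (T \<chi> - S \<chi> j) = - of_nat l"
proof -
  have "(\<Sum>g\<in>carrier G - {\<one>}. \<chi> g) = - 1"
    using sum_character[OF \<chi>] fin by (simp add: sum_diff1 character_one[OF \<chi>(1)])
  then show ?thesis using character_equation[OF j \<chi>(1)] by simp
qed

text \<open>This is \<open>character_equation\<close> for the trivial character.\<close>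

lemma parameter_equation: "k ^ 2 * (m - 1) = l * (v - 1)"
proof -
  have c: "character G (\<lambda>_. 1)" by (simp add: character_def)
  have j: "1 \<in> {1..m}" using m by simp
  have S: "S (\<lambda>_. 1) j = of_nat k" if "j \<in> {1..m}" for j
    using block[OF that] by (simp add: S_def)
  then have T: "T (\<lambda>_. 1) = of_nat (m * k)" by (simp add: T_def)
  have "of_nat k * (of_nat (m * k) - of_nat k) = (of_nat l * of_nat (card (carrier G - {\<one>})) :: complex)"
    using character_equation[OF j c] S[OF j] T by simp
  then have "(of_nat (k * (m * k - k)) :: complex) = of_nat (l * (v - 1))"
    using m ord fin by (simp add: Coset.order_def of_nat_diff card_Diff_singleton)
  then have "k * (m * k - k) = l * (v - 1)" by (simp only: of_nat_eq_iff)
  then show ?thesis by (simp add: power2_eq_square algebra_simps)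
qed

lemma card_Union: "card (\<Union>j\<in>{1..m}. D j) = m * k"
proof -
  have "card (\<Union>j\<in>{1..m}. D j) = (\<Sum>j\<in>{1..m}. card (D j))"
    using disj block(3) by (intro card_UN_disjoint) (auto simp: disjoint_family_on_def)
  then show ?thesis using block(2) by simp
qed

lemma Union_subset: "(\<Union>j\<in>{1..m}. D j) \<subseteq> carrier G"
  using block(1) by blast

lemma T_eq_sum_Union: "T \<chi> = (\<Sum>x\<in>(\<Union>j\<in>{1..m}. D j). \<chi> x)"
  using sum_Union[of "{1..m}" \<chi>] by (simp add: T_def S_def)

lemma km_less_v: "k * m < v"
proof -
  have le: "k * m \<le> v"
    using card_mono[OF fin Union_subset] card_Union ord by (simp add: Coset.order_def mult.commute)
  \<comment> \<open>If the blocks covered the group, \<open>k\<close> would divide \<open>v\<close>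
    and be prime to \<open>v - 1\<close>, while the parameter equation gives
    \<open>v - 1 dvd k * (k - 1)\<close>; so \<open>v - 1\<close> would divide the smaller positive
    number \<open>k - 1\<close>.\<close>
  moreover have "k * m \<noteq> v"
  proof
    assume eq: "k * m = v"
    have k1: "k ^ 2 * (m - 1) + k ^ 2 = k * v"
      using m eq by (cases m) (auto simp: power2_eq_square algebra_simps)
    have "k * (v - 1) = l * (v - 1) + k * (k - 1)"
      using k1 parameter_equation v_pos k by (simp add: algebra_simps power2_eq_square)
    then have "v - 1 dvd k * (k - 1)" by (metis dvd_add_right_iff dvd_triv_right)
    moreover have "coprime (v - 1) k"
    proof -
      have "coprime (v - 1) v" by (rule coprime_diff_one_left_nat[OF v_pos])
      then show ?thesis using eq by auto
    qed
    ultimately have "v - 1 dvd k - 1" by (simp add: coprime_dvd_mult_right_iff)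
    then have "v \<le> k" using k by (auto dest: dvd_imp_le)
    moreover have "k * 2 < k * m" using m k by simp
    ultimately show False using eq k by linarith
  qed
  ultimately show ?thesis by simp
qed

lemma l_less_k: "l < k"
proof -
  have "l * (v - 1) = k * (k * m - k)"
    using parameter_equation by (simp add: power2_eq_square algebra_simps)
  also have "k \<le> k * m" using m by simp
  then have "k * m - k < v - 1" using km_less_v k by linarith
  then have "k * (k * m - k) < k * (v - 1)" using k by simp
  finally show ?thesis by simp
qed

text \<open>\<open>A\<close> holds the blocks with positive ratio \<open>y / (y - x)\<close> to
  \<open>T \<chi>\<close>, the others have ratio \<open>- x / (y - x)\<close>. The condition
  \<open>x < y\<close> makes \<open>A\<close> the smaller class.\<close>

definition splits :: "('a \<Rightarrow> complex) \<Rightarrow> nat \<Rightarrow> nat \<Rightarrow> nat \<Rightarrow> nat \<Rightarrow> complex \<Rightarrow> nat set \<Rightarrow> bool" where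
  "splits \<chi> g x y n t A \<longleftrightarrow>
     coprime x y \<and> 0 < x \<and> x < y \<and> 0 < g \<and> g * (x + y) + 2 = m \<and>
     A \<subseteq> {1..m} \<and> card A = g * x + 1 \<and> card ({1..m} - A) = g * y + 1 \<and>
     (\<forall>j\<in>A. S \<chi> j = of_nat y * t) \<and> (\<forall>j\<in>{1..m} - A. S \<chi> j = - of_nat x * t) \<and>
     algebraic_int t \<and> t * cnj t = of_nat n \<and> l = n * x * y \<and> T \<chi> = of_nat (y - x) * t"

lemma algebraic_int_S:
  assumes "j \<in> {1..m}" "character G \<chi>"
  shows "algebraic_int (S \<chi> j)"
  unfolding S_def
  using block(1)[OF assms(1)] character_root_of_unity[OF assms(2)] v_pos ord
  by (intro algebraic_int_sum algebraic_int_root_of_unity[of _ v]) auto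

text \<open>The block equation reads
  \<open>S \<chi> j * cnj (T \<chi>) = |S \<chi> j|^2 - l\<close>, so the ratios to
  \<open>T \<chi>\<close> are real. They are roots of \<open>X^2 - X - l / |T \<chi>|^2\<close>,
  that is \<open>1 + h\<close> or \<open>- h\<close>, and add up to 1.\<close>

lemma real_ratio:
  assumes \<chi>: "character G \<chi>" "a \<in> carrier G" "\<chi> a \<noteq> 1" and nz: "T \<chi> \<noteq> 0"
  obtains h :: real and A where "h > 0" "h * (h + 1) * cmod (T \<chi>) ^ 2 = l" "A \<subseteq> {1..m}"
    "\<And>j. j \<in> A \<Longrightarrow> S \<chi> j = of_real (1 + h) * T \<chi>"
    "\<And>j. j \<in> {1..m} - A \<Longrightarrow> S \<chi> j = - of_real h * T \<chi>"
    "card A * (1 + h) - card ({1..m} - A) * h = 1"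
proof -
  define Z where "Z = T \<chi>"
  define N where "N = cmod Z ^ 2"
  have Z: "Z \<noteq> 0" using nz by (simp add: Z_def)
  have N: "N > 0" using Z by (simp add: N_def)
  have ZN: "Z * cnj Z = of_real N" using complex_norm_square[of Z] by (simp add: N_def)
  define \<alpha> where "\<alpha> j = (cmod (S \<chi> j) ^ 2 - l) / N" for j
  have S: "S \<chi> j = of_real (\<alpha> j) * Z" and q: "\<alpha> j * \<alpha> j * N = \<alpha> j * N + l" if j: "j \<in> {1..m}" for j
  proof -
    have sq: "S \<chi> j * cnj (S \<chi> j) = of_real (cmod (S \<chi> j) ^ 2)"
      using complex_norm_square[of "S \<chi> j"] by simp
    have "S \<chi> j * cnj Z = of_real (cmod (S \<chi> j) ^ 2 - l)"
      using nontrivial_character_equation[OF j \<chi>] sq by (simp add: Z_def algebra_simps)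
    then have "S \<chi> j * (Z * cnj Z) = of_real (cmod (S \<chi> j) ^ 2 - l) * Z" by (simp add: mult_ac)
    then show S: "S \<chi> j = of_real (\<alpha> j) * Z"
      using N ZN by (simp add: \<alpha>_def field_simps)
    have "cmod (S \<chi> j) ^ 2 = \<alpha> j * \<alpha> j * N"
      by (simp add: S N_def norm_mult power_mult_distrib power2_eq_square)
    moreover have "\<alpha> j * N = cmod (S \<chi> j) ^ 2 - l" using N by (simp add: \<alpha>_def)
    ultimately show "\<alpha> j * \<alpha> j * N = \<alpha> j * N + l" by simp
  qed
  \<comment> \<open>Minus the negative root of that quadratic equation.\<close>
  define h where "h = (sqrt (1 + 4 * (l / N)) - 1) / 2"
  have lN: "l / N > 0" using l N by simp
  then have "sqrt (1 + 4 * (l / N)) > 1" by simp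
  then have h: "h > 0" by (simp add: h_def)
  have "2 * h + 1 = sqrt (1 + 4 * (l / N))" by (simp add: h_def field_simps)
  then have "(2 * h + 1) ^ 2 = 1 + 4 * (l / N)" using lN by simp
  moreover have "(2 * h + 1) ^ 2 = 4 * (h * (h + 1)) + 1"
    by (simp add: power2_eq_square algebra_simps)
  ultimately have hh: "h * (h + 1) = l / N" by linarith
  then have hN: "h * (h + 1) * N = l" using N by simp
  have \<alpha>: "\<alpha> j = 1 + h \<or> \<alpha> j = - h" if j: "j \<in> {1..m}" for j
  proof -
    have "\<alpha> j * \<alpha> j * N = \<alpha> j * N + h * (h + 1) * N" using q[OF j] hN by simp
    then have "(\<alpha> j * \<alpha> j) * N = (\<alpha> j + h * (h + 1)) * N" by (simp add: distrib_right)
    then have "\<alpha> j * \<alpha> j = \<alpha> j + h * (h + 1)" using N by simp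
    then have "(\<alpha> j - (1 + h)) * (\<alpha> j + h) = 0" by (simp add: algebra_simps)
    then show ?thesis by auto
  qed
  define A where "A = {j \<in> {1..m}. \<alpha> j = 1 + h}"
  have "Z = (\<Sum>j\<in>{1..m}. of_real (\<alpha> j) * Z)"
    using S by (simp add: T_def Z_def)
  then have "of_real (\<Sum>j\<in>{1..m}. \<alpha> j) * Z = 1 * Z" by (simp add: sum_distrib_right)
  then have "of_real (\<Sum>j\<in>{1..m}. \<alpha> j) = (1 :: complex)" using Z by (metis mult_right_cancel)
  then have sum1: "(\<Sum>j\<in>{1..m}. \<alpha> j) = 1" by (simp only: of_real_eq_1_iff)
  have "(\<Sum>j\<in>{1..m}. \<alpha> j) = (\<Sum>j\<in>{1..m} - A. \<alpha> j) + (\<Sum>j\<in>A. \<alpha> j)"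
    by (rule sum.subset_diff) (auto simp: A_def)
  also have "(\<Sum>j\<in>A. \<alpha> j) = card A * (1 + h)" by (simp add: A_def)
  also have "(\<Sum>j\<in>{1..m} - A. \<alpha> j) = (\<Sum>j\<in>{1..m} - A. - h)"
    using \<alpha> by (intro sum.cong) (auto simp: A_def)
  also have "\<dots> = - (card ({1..m} - A) * h)" by simp
  finally have "card A * (1 + h) - card ({1..m} - A) * h = 1" using sum1 by simp
  moreover have "S \<chi> j = of_real (1 + h) * T \<chi>" if "j \<in> A" for j
    using S[of j] that by (simp add: A_def Z_def)
  moreover have "S \<chi> j = - of_real h * T \<chi>" if j: "j \<in> {1..m} - A" for j
  proof -
    have "\<alpha> j = - h" using \<alpha>[of j] j by (auto simp: A_def)
    with S[of j] j show ?thesis by (simp add: Z_def)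
  qed
  ultimately show ?thesis
    using h hN by (intro that[of h A]) (auto simp: A_def N_def Z_def)
qed

text \<open>Counting both classes gives \<open>h * (M - P) = P - 1\<close>, so \<open>h\<close> is
  rational. Removing the gcd of \<open>P - 1\<close> and \<open>M - 1\<close> produces
  \<open>x\<close>, \<open>y\<close> and \<open>g\<close>.\<close>

lemma splits_exists:
  assumes \<chi>: "character G \<chi>" "a \<in> carrier G" "\<chi> a \<noteq> 1" and nz: "T \<chi> \<noteq> 0"
  obtains g x y n t A where "splits \<chi> g x y n t A"
proof -
  obtain h :: real and A where h: "h > 0" "h * (h + 1) * cmod (T \<chi>) ^ 2 = l" and A: "A \<subseteq> {1..m}"
    and plus: "\<And>j. j \<in> A \<Longrightarrow> S \<chi> j = of_real (1 + h) * T \<chi>"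
    and minus: "\<And>j. j \<in> {1..m} - A \<Longrightarrow> S \<chi> j = - of_real h * T \<chi>"
    and c: "card A * (1 + h) - card ({1..m} - A) * h = 1"
    using real_ratio[OF assms] by blast
  define P where "P = card A"
  define M where "M = card ({1..m} - A)"
  have PM: "P + M = m"
    unfolding P_def M_def using A by (simp add: card_Diff_subset finite_subset card_mono[of "{1..m}" A, simplified])
  have eq: "P * (1 + h) - M * h = 1" using c by (simp add: P_def M_def)
  have P1: "P \<ge> 1"
  proof (rule ccontr)
    assume "\<not> P \<ge> 1"
    then have "P = 0" by simp
    then have "- (M * h) = 1" using eq by simp
    moreover have "M * h \<ge> 0" using h by simp
    ultimately show False by linarith
  qed
  have eq': "real P - 1 = h * (real M - real P)" using eq by (simp add: algebra_simps)
  \<comment> \<open>Otherwise the left side of \<open>P - 1 = h * (M - P)\<close> is at most 0,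
    which forces \<open>P = M = 1\<close>; this is where \<open>m > 2\<close> enters.\<close>
  have MP: "M > P"
  proof (rule ccontr)
    assume "\<not> M > P"
    then have "h * (real M - real P) \<le> 0" using h by (simp add: mult_nonneg_nonpos)
    then have "P = 1" using eq' P1 by linarith
    then have "h * (real M - 1) = 0" using eq' by simp
    then have "M = 1" using h by simp
    with \<open>P = 1\<close> PM m show False by simp
  qed
  then have "h * (real M - real P) > 0" using h by simp
  then have P2: "P > 1" using eq' by linarith
  define g where "g = gcd (P - 1) (M - 1)"
  have g: "g > 0" using P2 by (simp add: g_def)
  define x y where "x = (P - 1) div g" and "y = (M - 1) div g"
  have Px: "P = g * x + 1" and My: "M = g * y + 1"
    using P2 MP by (simp_all add: x_def y_def g_def)
  have cop: "coprime x y" using P2 unfolding x_def y_def g_def by (intro div_gcd_coprime) auto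
  have x: "x > 0" using Px P2 by (cases x) auto
  have xy: "x < y" using Px My MP g by simp
  define d where "d = real y - real x"
  have d: "d > 0" using xy by (simp add: d_def)
  have "real g * real x = h * (real g * d)" using eq' Px My by (simp add: d_def algebra_simps)
  then have hd: "h * d = x" using g by simp
  define t where "t = T \<chi> / of_real d"
  have td: "T \<chi> = of_real d * t" using d by (simp add: t_def)
  have dyx: "of_real d = (of_nat (y - x) :: complex)" using xy by (simp add: d_def of_nat_diff)
  have plus': "S \<chi> j = of_nat y * t" if "j \<in> A" for j
  proof -
    have "S \<chi> j = of_real ((1 + h) * d) * t" using plus[OF that] td by simp
    also have "(1 + h) * d = real y" using hd by (simp add: d_def algebra_simps)
    finally show ?thesis by simp
  qed
  have minus': "S \<chi> j = - of_nat x * t" if "j \<in> {1..m} - A" for j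
  proof -
    have "S \<chi> j = - of_real (h * d) * t" using minus[OF that] td by simp
    with hd show ?thesis by simp
  qed
  have "card A \<noteq> 0" using P2 by (simp add: P_def)
  then obtain i where i: "i \<in> A" by fastforce
  have "card ({1..m} - A) \<noteq> 0" using P2 MP unfolding M_def by linarith
  then obtain j where "j \<in> {1..m} - A" by (metis card.empty ex_in_conv)
  with i have ij: "i \<in> A" "j \<in> {1..m} - A" .
  \<comment> \<open>Bezout coefficients exhibit \<open>t\<close> as an integer combination of two
    block sums, hence as an algebraic integer.\<close>
  obtain u w where uw: "u * int x + w * int y = 1"
    using bezout_int[of "int x" "int y"] cop by auto
  have "t = of_int (u * int x + w * int y) * t" by (simp add: uw)
  also have "\<dots> = of_int w * (of_nat y * t) - of_int u * (- of_nat x * t)"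
    by (simp add: algebra_simps)
  also have "\<dots> = of_int w * S \<chi> i - of_int u * S \<chi> j" using plus'[OF ij(1)] minus'[OF ij(2)] by simp
  finally have tS: "t = of_int w * S \<chi> i - of_int u * S \<chi> j" .
  have t: "algebraic_int t"
    by (subst tS)
       (use ij A \<chi>(1) in \<open>auto intro!: algebraic_int_diff algebraic_int_mult algebraic_int_S\<close>)
  have norm: "cmod (T \<chi>) ^ 2 = d ^ 2 * cmod t ^ 2" using td d by (simp add: norm_mult power_mult_distrib)
  have "(h * d) * (h * d + d) * cmod t ^ 2 = l"
    using h(2) norm by (simp add: power2_eq_square algebra_simps)
  then have lt: "real x * real y * cmod t ^ 2 = l" using hd by (simp add: d_def)
  then have "cmod t ^ 2 = real l / (real x * real y)" using x xy by (simp add: field_simps)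
  then have tt: "t * cnj t = of_real (real l / (real x * real y))"
    using complex_norm_square[of t] by simp
  \<comment> \<open>The squared norm of \<open>t\<close> is rational, equal to
    \<open>l / (x * y)\<close>, and an algebraic integer, hence an integer.\<close>
  have "t * cnj t \<in> \<rat>" unfolding tt by (auto intro!: Rats_divide Rats_mult)
  moreover have "algebraic_int (t * cnj t)" using t by (auto intro: algebraic_int_mult)
  ultimately have "t * cnj t \<in> \<int>" by (intro rational_algebraic_int_is_int)
  then obtain z where z: "t * cnj t = of_int z" by (auto elim: Ints_cases)
  then have zt: "real_of_int z = cmod t ^ 2"
    using complex_norm_square[of t] by (metis of_real_eq_iff of_real_of_int_eq)
  then have "z \<ge> 0" by (metis of_int_0_le_iff zero_le_power2)
  define n where "n = nat z"
  have n: "t * cnj t = of_nat n" "cmod t ^ 2 = real n" using z zt \<open>z \<ge> 0\<close> by (simp_all add: n_def)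
  have "real l = real (n * x * y)" using lt n(2) by (simp add: mult_ac)
  then have l': "l = n * x * y" by (simp only: of_nat_eq_iff)
  have "splits \<chi> g x y n t A"
    unfolding splits_def
    using cop x xy g PM Px My A P_def M_def plus' minus' t n(1) l' td dyx
    by (auto simp: algebra_simps)
  then show ?thesis by (rule that)
qed

end

lemma complex_eq_one_if_coprime_powers:
  fixes z :: complex
  assumes "z ^ a = 1" "z ^ b = 1" "coprime a b" "a > 0"
  shows "z = 1"
proof -
  obtain x y where "a * x = b * y + 1"
    using bezout_nat[of a b] assms(3,4) by auto
  then have "z ^ (a * x) = z ^ (b * y) * z" by (metis power_add power_one_right)
  then show ?thesis using assms(1,2) by (simp add: power_mult)
qed

section \<open>Congruences between character sums modulo primes\<close>

context sedf_family
begin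

lemma S_cong:
  assumes "\<And>z. z \<in> carrier G \<Longrightarrow> \<chi> z - \<psi> z \<in> prime_rad r" "j \<in> {1..m}"
  shows "S \<chi> j - S \<psi> j \<in> prime_rad r"
  unfolding S_def sum_subtractf[symmetric]
  using assms(1) block(1)[OF assms(2)] by (intro prime_rad_sum) blast

lemma T_cong:
  assumes "\<And>z. z \<in> carrier G \<Longrightarrow> \<chi> z - \<psi> z \<in> prime_rad r"
  shows "T \<chi> - T \<psi> \<in> prime_rad r"
  unfolding T_def sum_subtractf[symmetric] using S_cong[OF assms] by (intro prime_rad_sum)

text \<open>Since \<open>\<chi>\<close> is congruent to 1 above \<open>r\<close>, multiplication by
  it does not change residues. The case of trivial \<open>\<psi>\<close> compares
  \<open>\<chi>\<close> with the trivial character.\<close>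

lemma prime_power_character_cong:
  assumes r: "Factorial_Ring.prime r" and \<chi>: "\<And>z. z \<in> carrier G \<Longrightarrow> \<chi> z ^ (r ^ e) = 1"
    and \<psi>: "character G \<psi>" and z: "z \<in> carrier G"
  shows "\<psi> z * \<chi> z - \<psi> z \<in> prime_rad r"
proof -
  have "algebraic_int (- \<psi> z)"
    using algebraic_int_root_of_unity[OF character_root_of_unity[OF \<psi> z]] v_pos ord by simp
  then have "(- \<psi> z) * (1 - \<chi> z) \<in> prime_rad r"
    by (intro prime_rad_mult one_minus_prime_power_root_in_prime_rad[OF r \<chi>[OF z]])
  then show ?thesis by (simp add: algebra_simps)
qed

lemma trivial_S: "j \<in> {1..m} \<Longrightarrow> S (\<lambda>_. 1) j = of_nat k"
  using block by (simp add: S_def)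

lemma trivial_T: "T (\<lambda>_. 1) = of_nat (m * k)"
  using trivial_S by (simp add: T_def)

lemma prime_dvd_if_prime_power_sum_vanishes:
  assumes r: "Factorial_Ring.prime r" and \<chi>: "\<And>z. z \<in> carrier G \<Longrightarrow> \<chi> z ^ (r ^ e) = 1"
    and "T \<chi> = 0"
  shows "r dvd m * k"
proof -
  have "1 * \<chi> z - 1 \<in> prime_rad r" if "z \<in> carrier G" for z
    by (rule prime_power_character_cong[where \<psi> = "\<lambda>_. 1", OF r \<chi> _ that]) (auto simp: character_def)
  then have "T \<chi> - T (\<lambda>_. 1) \<in> prime_rad r" by (intro T_cong) simp
  then have "- (T \<chi> - T (\<lambda>_. 1)) \<in> prime_rad r" by (rule prime_rad_uminus)
  then have "of_nat (m * k) \<in> prime_rad r" by (simp add: assms(3) trivial_T)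
  then show ?thesis by (rule of_nat_in_prime_rad_imp_dvd[OF r])
qed

lemma splits_simps:
  assumes "splits \<chi> g x y n t A"
  shows "coprime x y" "0 < x" "x < y" "0 < g" "g * (x + y) + 2 = m" "A \<subseteq> {1..m}"
    "card A = g * x + 1" "card ({1..m} - A) = g * y + 1"
    "\<And>j. j \<in> A \<Longrightarrow> S \<chi> j = of_nat y * t" "\<And>j. j \<in> {1..m} - A \<Longrightarrow> S \<chi> j = - of_nat x * t"
    "algebraic_int t" "t * cnj t = of_nat n" "l = n * x * y" "T \<chi> = of_nat (y - x) * t"
    "n > 0" "x + y dvd m - 2"
proof -
  show "n > 0" using assms l by (auto simp: splits_def intro: gr0I)
  have "m - 2 = g * (x + y)" using assms by (auto simp: splits_def)
  then show "x + y dvd m - 2" by simp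
qed (use assms in \<open>auto simp: splits_def\<close>)

lemma splits_nonempty:
  assumes "splits \<chi> g x y n t A"
  obtains i j where "i \<in> A" "j \<in> {1..m} - A"
proof -
  have "card A \<noteq> 0" "card ({1..m} - A) \<noteq> 0"
    unfolding splits_simps(7)[OF assms] splits_simps(8)[OF assms] by simp_all
  then have "A \<noteq> {}" "{1..m} - A \<noteq> {}" by (metis card.empty)+
  then show ?thesis using that by blast
qed

text \<open>Both \<open>y * t\<close> and \<open>- x * t\<close> are congruent to \<open>k\<close>
  above \<open>r\<close>; eliminating \<open>t\<close> leaves \<open>(x + y) * k\<close>.\<close>

lemma prime_dvd_splits_sum:
  assumes r: "Factorial_Ring.prime r" and \<chi>: "\<And>z. z \<in> carrier G \<Longrightarrow> \<chi> z ^ (r ^ e) = 1"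
    and s: "splits \<chi> g x y n t A" and k: "\<not> r dvd k"
  shows "r dvd x + y"
proof -
  have "1 * \<chi> z - 1 \<in> prime_rad r" if "z \<in> carrier G" for z
    by (rule prime_power_character_cong[where \<psi> = "\<lambda>_. 1", OF r \<chi> _ that]) (auto simp: character_def)
  then have c: "S \<chi> j - of_nat k \<in> prime_rad r" if "j \<in> {1..m}" for j
    using S_cong[of \<chi> "\<lambda>_. 1" r j] that by (simp add: trivial_S)
  obtain i j where ij: "i \<in> A" "j \<in> {1..m} - A" using splits_nonempty[OF s] by blast
  have i: "of_nat y * t - of_nat k \<in> prime_rad r"
    using c[of i] ij splits_simps(6,9)[OF s] by auto
  have j: "- of_nat x * t - of_nat k \<in> prime_rad r"
    using c[of j] ij splits_simps(10)[OF s] by auto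
  have "of_nat x * (of_nat y * t - of_nat k) + of_nat y * (- of_nat x * t - of_nat k) \<in> prime_rad r"
    using i j by (intro prime_rad_add prime_rad_mult) simp_all
  then have "- (of_nat x * (of_nat y * t - of_nat k) + of_nat y * (- of_nat x * t - of_nat k)) \<in> prime_rad r"
    by (rule prime_rad_uminus)
  then have "of_nat ((x + y) * k) \<in> prime_rad r" by (simp add: algebra_simps)
  then have "r dvd (x + y) * k" by (rule of_nat_in_prime_rad_imp_dvd[OF r])
  then show ?thesis using k r by (simp add: prime_dvd_mult_iff)
qed

text \<open>Multiplying by \<open>cnj t\<close> replaces \<open>t\<close> by the integer
  \<open>n\<close>, a divisor of \<open>l\<close> and so prime to \<open>r\<close>.\<close>

lemma prime_dvd_multiplier:
  assumes r: "Factorial_Ring.prime r" and s: "splits \<chi> g x y n t A" and l: "\<not> r dvd l"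
    and "of_nat c * t \<in> prime_rad r"
  shows "r dvd c"
proof -
  have "cnj t * (of_nat c * t) \<in> prime_rad r"
    using splits_simps(11)[OF s] by (intro prime_rad_mult[OF assms(4)]) simp
  also have "cnj t * (of_nat c * t) = of_nat (c * n)"
    by (simp add: mult_ac flip: splits_simps(12)[OF s])
  finally have "r dvd c * n" by (rule of_nat_in_prime_rad_imp_dvd[OF r])
  moreover have "\<not> r dvd n" using l splits_simps(13)[OF s] by auto
  ultimately show ?thesis using r by (simp add: prime_dvd_mult_iff)
qed

lemma prime_dvd_splits_sum_if_separated:
  assumes r: "Factorial_Ring.prime r" and s: "splits \<chi> g x y n t A" and l: "\<not> r dvd l"
    and ij: "i \<in> A" "j \<in> {1..m} - A" and "S \<chi> i - S \<chi> j \<in> prime_rad r"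
  shows "r dvd x + y"
proof (rule prime_dvd_multiplier[OF r s l])
  have "S \<chi> i - S \<chi> j = of_nat (x + y) * t"
    using splits_simps(9,10)[OF s] ij by (simp add: algebra_simps)
  then show "of_nat (x + y) * t \<in> prime_rad r" using assms(6) by simp
qed

text \<open>As \<open>r\<close> does not divide \<open>x + y\<close>, two blocks have congruent sums
  exactly when they lie in the same class. So both characters divide the blocks into the same two
  classes, whose sizes determine the ratio of \<open>x\<close> to \<open>y\<close>.\<close>

lemma splits_agree:
  assumes r: "Factorial_Ring.prime r" and l: "\<not> r dvd l" and rm: "\<not> r dvd m - 2"
    and s: "splits \<chi> g x y n t A" and s': "splits \<psi> g' x' y' n' t' A'"
    and cong: "\<And>z. z \<in> carrier G \<Longrightarrow> \<chi> z - \<psi> z \<in> prime_rad r"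
  shows "x = x'" "y = y'"
proof -
  note s1 = splits_simps[OF s] and s2 = splits_simps[OF s']
  have c: "S \<chi> j - S \<psi> j \<in> prime_rad r" if "j \<in> {1..m}" for j
    using S_cong[OF cong that] .
  have nr: "\<not> r dvd x + y" "\<not> r dvd x' + y'" using rm s1(16) s2(16) dvd_trans by blast+
  have eq: "S \<chi> i - S \<chi> j \<in> prime_rad r \<longleftrightarrow> S \<psi> i - S \<psi> j \<in> prime_rad r"
    if "i \<in> {1..m}" "j \<in> {1..m}" for i j
  proof -
    have d: "(S \<chi> i - S \<psi> i) - (S \<chi> j - S \<psi> j) \<in> prime_rad r"
      by (rule prime_rad_diff[OF c[OF that(1)] c[OF that(2)]])
    have e: "S \<chi> i - S \<chi> j = ((S \<chi> i - S \<psi> i) - (S \<chi> j - S \<psi> j)) + (S \<psi> i - S \<psi> j)"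
      "S \<psi> i - S \<psi> j = (S \<chi> i - S \<chi> j) - ((S \<chi> i - S \<psi> i) - (S \<chi> j - S \<psi> j))" by simp_all
    show ?thesis
      using prime_rad_add[OF d] prime_rad_diff[OF _ d] e by metis
  qed
  have A: "S \<chi> i - S \<chi> j \<in> prime_rad r \<longleftrightarrow> (i \<in> A \<longleftrightarrow> j \<in> A)"
    if ij: "i \<in> {1..m}" "j \<in> {1..m}" for i j
  proof -
    have "(S \<chi> i - S \<chi> j \<in> prime_rad r) = (S \<chi> j - S \<chi> i \<in> prime_rad r)"
      by (rule prime_rad_minus_commute)
    then show ?thesis
      using prime_dvd_splits_sum_if_separated[OF r s l] nr(1) ij s1(9,10)
      by (cases "i \<in> A"; cases "j \<in> A") auto
  qed
  have A': "S \<psi> i - S \<psi> j \<in> prime_rad r \<longleftrightarrow> (i \<in> A' \<longleftrightarrow> j \<in> A')"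
    if ij: "i \<in> {1..m}" "j \<in> {1..m}" for i j
  proof -
    have "(S \<psi> i - S \<psi> j \<in> prime_rad r) = (S \<psi> j - S \<psi> i \<in> prime_rad r)"
      by (rule prime_rad_minus_commute)
    then show ?thesis
      using prime_dvd_splits_sum_if_separated[OF r s' l] nr(2) ij s2(9,10)
      by (cases "i \<in> A'"; cases "j \<in> A'") auto
  qed
  have same: "(i \<in> A \<longleftrightarrow> j \<in> A) \<longleftrightarrow> (i \<in> A' \<longleftrightarrow> j \<in> A')"
    if "i \<in> {1..m}" "j \<in> {1..m}" for i j
    using A A' eq that by simp
  have "g * x < g * y" "g' * x' < g' * y'" using s1(3,4) s2(3,4) by simp_all
  obtain i where i: "i \<in> A" using splits_nonempty[OF s] by blast
  have gg: "g * x = g' * x'" "g * y = g' * y'"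
  proof -
    have "A = A'"
    proof (cases "i \<in> A'")
      case True
      then have "j \<in> A \<longleftrightarrow> j \<in> A'" if "j \<in> {1..m}" for j
        using same[of i j] i that s1(6) by blast
      then show ?thesis using s1(6) s2(6) by blast
    next
      case False
      then have *: "j \<in> A \<longleftrightarrow> j \<notin> A'" if "j \<in> {1..m}" for j
        using same[of i j] i that s1(6) by blast
      then have "{1..m} - A' = A" "{1..m} - A = A'" using s1(6) s2(6) by blast+
      \<comment> \<open>The classes cannot be interchanged, because \<open>A\<close> and
        \<open>A'\<close> are each the smaller of the two.\<close>
      then have "g * x = g' * y'" "g * y = g' * x'" using s1(7,8) s2(7,8) by simp_all
      with \<open>g * x < g * y\<close> \<open>g' * x' < g' * y'\<close> show ?thesis by simp
    qed
    then show "g * x = g' * x'" "g * y = g' * y'" using s1(7,8) s2(7,8) by simp_all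
  qed
  have "(g * g') * (x * y') = (g * g') * (x' * y)"
    using gg by (metis (no_types, opaque_lifting) mult.assoc mult.commute)
  then have xy: "x * y' = x' * y" using s1(4) s2(4) by simp
  have "x dvd x'" using xy s1(1) by (metis coprime_dvd_mult_left_iff dvd_triv_left)
  moreover have "x' dvd x" using xy s2(1) by (metis coprime_dvd_mult_left_iff dvd_triv_left)
  ultimately show "x = x'" by (rule dvd_antisym)
  then show "y = y'" using xy s1(2) by simp
qed

end

section \<open>Case analysis for order \<open>p * q ^ 2\<close>\<close>

theorem (in sedf_family) order_ne_prime_times_prime_square:
  assumes p: "Factorial_Ring.prime p" and q: "Factorial_Ring.prime q" and pq: "p \<noteq> q"
    and v: "v = p * q ^ 2"
  shows False
proof -
  have p0: "p > 0" and q0: "q > 0" using p q prime_gt_0_nat by blast+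
  have cop: "coprime p q" using p q pq by (simp add: primes_coprime)
  have eq: "k ^ 2 * (m - 1) = l * (p * q ^ 2 - 1)" using parameter_equation v by simp
  have km: "k * m < p * q ^ 2" using km_less_v v by simp
  have v0: "p * q ^ 2 > 0" using p0 q0 by simp
  have cv: "coprime (p * q ^ 2 - 1) (p * q ^ 2)" by (rule coprime_diff_one_left_nat[OF v0])
  \<comment> \<open>Both primes divide \<open>v\<close> and are therefore prime to
    \<open>v - 1\<close> in the parameter equation.\<close>
  have sq: "r ^ 2 dvd l" if "r dvd k" "r = p \<or> r = q" for r
  proof -
    have "coprime (r ^ 2) (p * q ^ 2 - 1)" using cv that(2) by (auto simp: coprime_commute)
    moreover have "r ^ 2 dvd k ^ 2 * (m - 1)" using that(1) by (intro dvd_mult2 dvd_power_same)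
    then have "r ^ 2 dvd l * (p * q ^ 2 - 1)" by (simp only: eq)
    ultimately show ?thesis by (metis coprime_dvd_mult_left_iff)
  qed
  obtain \<chi> a where \<chi>: "character G \<chi>" and \<chi>p: "\<And>z. z \<in> carrier G \<Longrightarrow> \<chi> z ^ (p ^ 1) = 1"
    and a: "a \<in> carrier G" "\<chi> a \<noteq> 1"
    using prime_power_character_exists[OF fin, of p 1 "q ^ 2"] ord v p cop by auto
  have pcases: "p dvd k \<or> (p dvd m \<and> \<not> p dvd k) \<or>
      (\<exists>g x y n t A. splits \<chi> g x y n t A \<and> p dvd x + y)"
  proof (cases "T \<chi> = 0")
    case True
    then show ?thesis
      using prime_dvd_if_prime_power_sum_vanishes[OF p \<chi>p] p by (auto simp: prime_dvd_mult_iff)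
  next
    case False
    obtain g x y n t A where s: "splits \<chi> g x y n t A" by (rule splits_exists[OF \<chi> a False])
    show ?thesis
    proof (cases "p dvd k")
      case False
      have "p dvd x + y" by (rule prime_dvd_splits_sum[OF p \<chi>p s False])
      with s show ?thesis by blast
    qed simp
  qed
  have l_ge: "r \<le> l + 1" if "splits \<psi> g x y n t A" "r dvd x + y" for \<psi> g x y n t A r
    using le_Suc_mult_if_dvd_add[of x y n r] splits_simps(2,3,13,15)[OF that(1)] that(2) by simp
  have lk: "l + 1 \<le> k" using l_less_k by simp
  \<comment> \<open>If every nontrivial character of \<open>q\<close>-power order vanishes on the
    union, all of \<open>q ^ 2\<close> divides \<open>m\<close>; otherwise one such character splits
    the blocks.\<close>
  consider (qk) "q dvd k" | (van) "\<not> q dvd k" "q ^ 2 dvd m"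
    | (split) \<psi> g x y n t A where "\<not> q dvd k" "character G \<psi>"
        "\<And>z. z \<in> carrier G \<Longrightarrow> \<psi> z ^ (q ^ 2) = 1" "splits \<psi> g x y n t A"
  proof (cases "q dvd k")
    case qk: False
    show ?thesis
    proof (cases "\<exists>\<psi> b. character G \<psi> \<and> (\<forall>z\<in>carrier G. \<psi> z ^ (q ^ 2) = 1) \<and>
        b \<in> carrier G \<and> \<psi> b \<noteq> 1 \<and> T \<psi> \<noteq> 0")
      case True
      then obtain \<psi> b where \<psi>: "character G \<psi>" "\<And>z. z \<in> carrier G \<Longrightarrow> \<psi> z ^ (q ^ 2) = 1"
        and b: "b \<in> carrier G" "\<psi> b \<noteq> 1" "T \<psi> \<noteq> 0" by blast
      obtain g x y n t A where s: "splits \<psi> g x y n t A" by (rule splits_exists[OF \<psi>(1) b])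
      show ?thesis by (rule that(3)[OF qk \<psi> s])
    next
      case False
      have "Coset.order G = q ^ 2 * p" "coprime q p" using ord v cop by (simp_all add: coprime_commute)
      then have "q ^ 2 dvd card (\<Union>j\<in>{1..m}. D j)"
      proof (rule prime_power_dvd_card_if_character_sums_vanish[OF fin _ q _ Union_subset])
        fix \<psi> b assume "character G \<psi>" "\<And>z. z \<in> carrier G \<Longrightarrow> \<psi> z ^ (q ^ 2) = 1"
          "b \<in> carrier G" "\<psi> b \<noteq> 1"
        then have "T \<psi> = 0" using False by blast
        then show "(\<Sum>x\<in>(\<Union>j\<in>{1..m}. D j). \<psi> x) = 0" by (simp only: T_eq_sum_Union)
      qed
      then have "q ^ 2 dvd m * k" using card_Union by simp
      moreover have "coprime (q ^ 2) k" using qk q by (simp add: prime_imp_coprime)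
      ultimately show ?thesis using that(2) qk by (simp add: coprime_dvd_mult_left_iff)
    qed
  qed (use that in blast)
  then show False
  proof cases
    case qk
    show False
    proof (cases "p dvd k")
      case True
      have "p ^ 2 * q ^ 2 dvd l" using sq[OF True] sq[OF qk] cop by (intro divides_mult) auto
      then have "p ^ 2 * q ^ 2 \<le> l" using l by (intro dvd_imp_le) auto
      moreover have "p * q ^ 2 \<le> p ^ 2 * q ^ 2" using p0 by (simp add: power2_eq_square)
      moreover have "k * 1 \<le> k * m" using m by (intro mult_le_mono2) simp
      ultimately show False using km lk by linarith
    next
      case False
      \<comment> \<open>In either case \<open>p \<le> m\<close>; together with
        \<open>q ^ 2 \<le> l < k\<close> this violates \<open>k * m < v\<close>.\<close>
      have "p dvd m \<or> p dvd m - 2" using pcases False splits_simps(16) dvd_trans by metis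
      then have pm: "p \<le> m" using m by (auto dest!: dvd_imp_le)
      have "q ^ 2 \<le> l" using sq[OF qk] l by (intro dvd_imp_le) auto
      then have "q ^ 2 * p \<le> k * m" using lk pm by (intro mult_le_mono) auto
      then show False using km by (simp add: mult.commute)
    qed
  next
    case van
    have "q ^ 2 \<le> m" using van(2) m by (intro dvd_imp_le) auto
    then have "k * q ^ 2 \<le> k * m" by simp
    then have "k * q ^ 2 < p * q ^ 2" using km by linarith
    then have kp: "k < p" by simp
    from pcases consider "p dvd k" | "p dvd m" | g x y n t A where "splits \<chi> g x y n t A" "p dvd x + y"
      by blast
    then show False
    proof cases
      case 1
      then show False using kp k by (auto dest!: dvd_imp_le)
    next
      case 2
      then have "p * q ^ 2 dvd m" using van(2) cop by (intro divides_mult) auto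
      then have "p * q ^ 2 \<le> m" using m by (intro dvd_imp_le) auto
      moreover have "1 * m \<le> k * m" using k by (intro mult_le_mono1) simp
      ultimately show False using km by linarith
    next
      case 3
      then show False using l_ge lk kp by fastforce
    qed
  next
    case (split \<psi> g x y n t A)
    note s = splits_simps[OF split(4)]
    have qs: "q dvd x + y" by (rule prime_dvd_splits_sum[OF q split(3,4,1)])
    then have qm: "q dvd m - 2" using s(16) dvd_trans by blast
    \<comment> \<open>Used for contradictions: \<open>q \<le> l + 1 \<le> k\<close> holds because
      \<open>q\<close> divides \<open>x + y\<close>.\<close>
    have small: "k < q" if "p * q \<le> m"
    proof -
      have "k * (p * q) \<le> k * m" using that by (rule mult_le_mono2)
      moreover have "k * (p * q) = (p * q) * k" "p * q ^ 2 = (p * q) * q"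
        by (simp_all add: power2_eq_square)
      ultimately have "(p * q) * k < (p * q) * q" using km by linarith
      then show ?thesis by simp
    qed
    have not_both: "\<not> p dvd m - 2"
    proof
      assume "p dvd m - 2"
      then have "p * q dvd m - 2" using qm cop by (intro divides_mult)
      then have "p * q \<le> m - 2" using m by (intro dvd_imp_le) auto
      then have "k < q" by (intro small) simp
      then show False using l_ge[OF split(4) qs] lk by simp
    qed
    have pk: "\<not> p dvd k"
      using no_parameters_p_dvd_k[OF p q0 m eq km _ l_less_k _ qm] l by auto
    with pcases not_both have pm: "p dvd m" using splits_simps(16) dvd_trans by metis
    have p2: "\<not> p dvd 2"
    proof
      assume "p dvd 2"
      then have "p dvd m - 2" using pm by simp
      with not_both show False by simp
    qed
    have "q \<noteq> 2"
    proof
      assume q2: "q = 2"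
      have "m = (m - 2) + 2" using m by simp
      then have "q dvd m" using qm q2 by (metis dvd_add dvd_refl)
      then have "p * q dvd m" using pm cop by (intro divides_mult)
      then have "k < q" using m by (intro small dvd_imp_le) auto
      then show False using q2 k by simp
    qed
    then have q2: "coprime q 2" using q by (metis prime_imp_coprime primes_coprime two_is_prime_nat)
    \<comment> \<open>This and \<open>ql\<close> allow \<open>t\<close> to be cancelled modulo
      primes above \<open>p\<close> and \<open>q\<close>.\<close>
    have pl: "\<not> p dvd l"
    proof
      assume "p dvd l"
      then have "p dvd k ^ 2 * (m - 1)" unfolding eq by (rule dvd_mult2)
      then have "p dvd m - 1" using p pk by (auto simp: prime_dvd_mult_iff dest: prime_dvd_power)
      then have "p dvd m - (m - 1)" by (rule dvd_diff_nat[OF pm])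
      moreover have "m - (m - 1) = 1" using m by simp
      ultimately have "p = 1" by simp
      then show False using p by simp
    qed
    have ql: "\<not> q dvd l"
    proof
      assume "q dvd l"
      then have "q dvd k ^ 2 * (m - 1)" unfolding eq by (rule dvd_mult2)
      then have "q dvd m - 1" using q split(1) by (auto simp: prime_dvd_mult_iff dest: prime_dvd_power)
      then have "q dvd (m - 1) - (m - 2)" by (rule dvd_diff_nat[OF _ qm])
      moreover have "(m - 1) - (m - 2) = 1" using m by simp
      ultimately have "q = 1" by simp
      then show False using q by simp
    qed
    have T0: "T \<chi> = 0"
    proof (rule ccontr)
      assume "T \<chi> \<noteq> 0"
      then obtain g' x' y' n' t' A' where s': "splits \<chi> g' x' y' n' t' A'"
        by (rule splits_exists[OF \<chi> a])
      have "p dvd x' + y'" by (rule prime_dvd_splits_sum[OF p \<chi>p s' pk])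
      then show False using not_both splits_simps(16)[OF s'] dvd_trans by blast
    qed
    \<comment> \<open>The mixed character: congruent to \<open>\<chi>\<close> above \<open>q\<close>
      and to \<open>\<psi>\<close> above \<open>p\<close>.\<close>
    define \<phi> where "\<phi> = (\<lambda>z. \<chi> z * \<psi> z)"
    have \<phi>: "character G \<phi>" unfolding \<phi>_def by (rule character_times[OF \<chi> split(2)])
    have "\<phi> a \<noteq> 1"
    proof
      assume "\<phi> a = 1"
      then have "\<chi> a ^ (q ^ 2) = 1"
        using split(3)[OF a(1)] by (metis \<phi>_def mult.right_neutral power_mult_distrib power_one)
      then show False
        using complex_eq_one_if_coprime_powers[of "\<chi> a" p "q ^ 2"] \<chi>p[OF a(1)] a(2) cop p0 by simp
    qed
    have \<phi>\<chi>: "\<phi> z - \<chi> z \<in> prime_rad q" if "z \<in> carrier G" for z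
      unfolding \<phi>_def by (rule prime_power_character_cong[OF q split(3) \<chi> that])
    have \<phi>\<psi>: "\<phi> z - \<psi> z \<in> prime_rad p" if "z \<in> carrier G" for z
      unfolding \<phi>_def mult.commute[of "\<chi> z"]
      by (rule prime_power_character_cong[OF p \<chi>p split(2) that])
    have T1: "T \<phi> - T \<chi> \<in> prime_rad q" by (rule T_cong) (rule \<phi>\<chi>)
    have T2: "T \<phi> - T \<psi> \<in> prime_rad p" by (rule T_cong) (rule \<phi>\<psi>)
    have T\<phi>: "T \<phi> = 0"
    proof (rule ccontr)
      assume "T \<phi> \<noteq> 0"
      then obtain g' x' y' n' t' A' where s': "splits \<phi> g' x' y' n' t' A'"
        by (rule splits_exists[OF \<phi> a(1) \<open>\<phi> a \<noteq> 1\<close>])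
      \<comment> \<open>Above \<open>p\<close> the splitting of \<open>\<phi>\<close> must have the
        same \<open>x\<close> and \<open>y\<close> as that of \<open>\<psi>\<close>; above
        \<open>q\<close> the vanishing of \<open>T \<chi>\<close> forces \<open>q dvd y - x\<close>.
        With \<open>q dvd x + y\<close> and \<open>q\<close> odd, this contradicts
        coprimality.\<close>
      have "x' = x" by (rule splits_agree(1)[OF p pl not_both s' split(4) \<phi>\<psi>])
      moreover have "y' = y" by (rule splits_agree(2)[OF p pl not_both s' split(4) \<phi>\<psi>])
      moreover have "T \<phi> \<in> prime_rad q" using T1 T0 by simp
      then have "q dvd y' - x'"
        unfolding splits_simps(14)[OF s'] by (rule prime_dvd_multiplier[OF q s' ql])
      ultimately have "q dvd y - x" by simp
      moreover have "(x + y) + (y - x) = y * 2" "(x + y) - (y - x) = x * 2" using s(3) by auto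
      ultimately have "q dvd y * 2" "q dvd x * 2" using qs by (metis dvd_add, metis dvd_diff_nat)
      then have "q dvd y" "q dvd x" using q2 by (auto simp: coprime_dvd_mult_left_iff)
      then have "q = 1" using s(1) coprime_common_divisor_nat by blast
      then show False using q by simp
    qed
    have "- (T \<phi> - T \<psi>) \<in> prime_rad p" by (rule prime_rad_uminus[OF T2])
    then have "T \<psi> \<in> prime_rad p" by (simp add: T\<phi>)
    then have "p dvd y - x" unfolding s(14) by (rule prime_dvd_multiplier[OF p split(4) pl])
    moreover have "odd p" using p p2 by (metis dvd_refl prime_nat_iff even_numeral primes_dvd_imp_eq two_is_prime_nat)
    ultimately show False
      by (intro no_parameters_p_dvd_m[OF p _ q0 s(1,2,3,4,5,15,13) eq km l_less_k pm qs])
  qed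
qed

theorem theorem30:
  fixes G :: "('a, 'b) monoid_scheme" and p q :: nat
  assumes "Factorial_Ring.prime p" and "Factorial_Ring.prime q" and "p \<noteq> q"
    and "comm_group G" and "finite (carrier G)" and "Coset.order G = p * q ^ 2"
  shows "\<not> (\<exists>m k l D. m > 2 \<and> k > 1 \<and> sedf G (p * q ^ 2) m k l D)"
proof
  assume "\<exists>m k l D. m > 2 \<and> k > 1 \<and> sedf G (p * q ^ 2) m k l D"
  then obtain m k l D where "m > 2" "k > 1" "sedf G (p * q ^ 2) m k l D" by blast
  with assms(4) interpret sedf_family G "p * q ^ 2" m k l D
    by (intro sedf_family.intro sedf_family_axioms.intro)
  show False by (rule order_ne_prime_times_prime_square[OF assms(1-3) refl])
qed

end
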